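(* Let $p(\cdot)\in\mathcal P^{\log}_\pm(\mathbb B)$. Then $B_{p(\cdot)}=B^+_{p(\cdot)}=B^{++}_{p(\cdot)}$ (as classes of weights not a.e. zero).
   Context: $\mathbb B$ unit ball of $\mathbb C^n$, $\alpha>0$, $d\mu_\alpha(z)=(1-|z|^2)^{\alpha-1}d\mu(z)$. Pseudo-distance $d(z,\zeta)=\big||z|-|\zeta|\big|+\big|1-\frac{\langle z,\zeta\rangle}{|z||\zeta|}\big|$ ($z,\zeta\ne0$), $d(z,\zeta)=|z|+|\zeta|$ otherwise; pseudo-balls $B(z,r)=\{\zeta:d(z,\zeta)<r\}$; $\mathcal B$ = pseudo-balls $B(z,r)$ with $r>1-|z|$. $\mathcal P^{\log}_\pm(\mathbb B)$: measurable $p$ with $\operatorname{ess\,inf}p>1$ and $|p(z)-p(\zeta)|\le c/\ln(e+1/d(z,\zeta))$ for some $c$ and all $z\ne\zeta$; $1/p+1/p'=1$. For an exponent $r(\cdot)$ bounded and bounded away from $0$: $\|f\|_{r(\cdot)}=\inf\{\lambda>0:\int|f/\lambda|^{r(z)}d\mu_\alpha\le1\}$. Weights are non-negative locally integrable functions; $w(E)=\int_Ew\,d\mu_\alpha$; $w'=w^{1-p'(\cdot)}$; $p_B=\big(\frac1{\mu_\alpha(B)}\int_B\frac1pd\mu_\alpha\big)^{-1}$. $w\in B_{p(\cdot)}$: $\sup_{B\in\mathcal B}\frac1{\mu_\alpha(B)}\|w^{1/p(\cdot)}\chi_B\|_{p(\cdot)}\|w^{-1/p(\cdot)}\chi_B\|_{p'(\cdot)}<\infty$.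 $w\in B^+_{p(\cdot)}$: $\sup_{B\in\mathcal B}\mu_\alpha(B)^{-p_B}w(B)\|w^{-1}\chi_B\|_{p'(\cdot)/p(\cdot)}<\infty$. $w\in B^{++}_{p(\cdot)}$: $\sup_{B\in\mathcal B}\frac{w(B)}{\mu_\alpha(B)}\big(\frac{w'(B)}{\mu_\alpha(B)}\big)^{p_B-1}<\infty$. *)

theory Defs
  imports "HOL-Analysis.Analysis"
begin

text \<open>Points of C^n are modelled as vectors of type complex^'n ('n finite, n = CARD('n)).
  norm is the Euclidean (Hermitian) norm.\<close>

definition cinner :: "complex^'n \<Rightarrow> complex^'n \<Rightarrow> complex" where
  "cinner z w = (\<Sum>i\<in>UNIV. z$i * cnj (w$i))"

abbreviation unit_ball :: "(complex^'n) set" where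
  "unit_ball \<equiv> ball 0 1"

definition mu_alpha :: "real \<Rightarrow> (complex^'n) measure" where
  "mu_alpha \<alpha> = density lborel
     (\<lambda>z. indicator (ball (0::complex^'n) 1) z *
          ennreal ((1 - (norm z)\<^sup>2) powr (\<alpha> - 1) / measure lborel (ball (0::complex^'n) 1)))"

definition pdist :: "complex^'n \<Rightarrow> complex^'n \<Rightarrow> real" where
  "pdist z \<zeta> = (if z \<noteq> 0 \<and> \<zeta> \<noteq> 0
     then \<bar>norm z - norm \<zeta>\<bar> + cmod (1 - cinner z \<zeta> / of_real (norm z * norm \<zeta>))
     else norm z + norm \<zeta>)"

definition pball :: "complex^'n \<Rightarrow> real \<Rightarrow> (complex^'n) set" where
  "pball z r = {\<zeta> \<in> unit_ball. pdist z \<zeta> < r}"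

definition pballs :: "(complex^'n) set set" where
  "pballs = {pball z r | z r. z \<in> unit_ball \<and> r > 1 - norm z}"

definition P_log :: "real \<Rightarrow> (complex^'n \<Rightarrow> real) \<Rightarrow> bool" where
  "P_log \<alpha> p \<longleftrightarrow> p \<in> borel_measurable (mu_alpha \<alpha>)
     \<and> (\<exists>p0>1. AE z in mu_alpha \<alpha>. p0 \<le> p z)
     \<and> (\<exists>c. \<forall>z\<in>unit_ball. \<forall>\<zeta>\<in>unit_ball. z \<noteq> \<zeta> \<longrightarrow>
            \<bar>p z - p \<zeta>\<bar> \<le> c / ln (exp 1 + 1 / pdist z \<zeta>))"

definition conj_exp :: "(complex^'n \<Rightarrow> real) \<Rightarrow> complex^'n \<Rightarrow> real" where
  "conj_exp p z = p z / (p z - 1)"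

text \<open>x^e for x in [0,infinity] and e > 0 (with infinity^e = infinity, 0^e = 0).\<close>
definition epow :: "ennreal \<Rightarrow> real \<Rightarrow> ennreal" where
  "epow x e = (if x = top then top else ennreal (enn2real x powr e))"

definition wpow :: "real \<Rightarrow> real \<Rightarrow> ennreal" where
  "wpow x e = (if x = 0 then (if e < 0 then top else if e = 0 then 1 else 0)
               else ennreal (x powr e))"

definition vnorm :: "real \<Rightarrow> (complex^'n \<Rightarrow> real) \<Rightarrow> (complex^'n \<Rightarrow> ennreal) \<Rightarrow> ennreal" where
  "vnorm \<alpha> r f = Inf {ennreal l | l. l > 0 \<and>
      (\<integral>\<^sup>+ z. epow (f z / ennreal l) (r z) \<partial>mu_alpha \<alpha>) \<le> 1}"

definition is_weight :: "real \<Rightarrow> (complex^'n \<Rightarrow> real) \<Rightarrow> bool" where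
  "is_weight \<alpha> w \<longleftrightarrow> w \<in> borel_measurable (mu_alpha \<alpha>) \<and> (\<forall>z. 0 \<le> w z)
     \<and> (\<forall>K. compact K \<and> K \<subseteq> unit_ball \<longrightarrow> set_integrable (mu_alpha \<alpha>) K w)"

definition wmeas :: "real \<Rightarrow> (complex^'n \<Rightarrow> real) \<Rightarrow> (complex^'n) set \<Rightarrow> ennreal" where
  "wmeas \<alpha> w E = (\<integral>\<^sup>+ z\<in>E. ennreal (w z) \<partial>mu_alpha \<alpha>)"

definition wdual_meas :: "real \<Rightarrow> (complex^'n \<Rightarrow> real) \<Rightarrow> (complex^'n \<Rightarrow> real) \<Rightarrow> (complex^'n) set \<Rightarrow> ennreal" where
  "wdual_meas \<alpha> p w E = (\<integral>\<^sup>+ z\<in>E. wpow (w z) (1 - conj_exp p z) \<partial>mu_alpha \<alpha>)"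

definition p_avg :: "real \<Rightarrow> (complex^'n \<Rightarrow> real) \<Rightarrow> (complex^'n) set \<Rightarrow> real" where
  "p_avg \<alpha> p B = inverse ((1 / measure (mu_alpha \<alpha>) B) * (\<integral>z\<in>B. 1 / p z \<partial>mu_alpha \<alpha>))"

definition class_B :: "real \<Rightarrow> (complex^'n \<Rightarrow> real) \<Rightarrow> (complex^'n \<Rightarrow> real) \<Rightarrow> bool" where
  "class_B \<alpha> p w \<longleftrightarrow> (\<exists>C::real. \<forall>B\<in>pballs.
     inverse (emeasure (mu_alpha \<alpha>) B)
       * vnorm \<alpha> p (\<lambda>z. indicator B z * wpow (w z) (1 / p z))
       * vnorm \<alpha> (conj_exp p) (\<lambda>z. indicator B z * wpow (w z) (- 1 / p z))
     \<le> ennreal C)"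

definition class_B_plus :: "real \<Rightarrow> (complex^'n \<Rightarrow> real) \<Rightarrow> (complex^'n \<Rightarrow> real) \<Rightarrow> bool" where
  "class_B_plus \<alpha> p w \<longleftrightarrow> (\<exists>C::real. \<forall>B\<in>pballs.
     ennreal (measure (mu_alpha \<alpha>) B powr (- p_avg \<alpha> p B))
       * wmeas \<alpha> w B
       * vnorm \<alpha> (\<lambda>z. conj_exp p z / p z) (\<lambda>z. indicator B z * wpow (w z) (-1))
     \<le> ennreal C)"

definition class_B_plus_plus :: "real \<Rightarrow> (complex^'n \<Rightarrow> real) \<Rightarrow> (complex^'n \<Rightarrow> real) \<Rightarrow> bool" where
  "class_B_plus_plus \<alpha> p w \<longleftrightarrow> (\<exists>C::real. \<forall>B\<in>pballs.
     (wmeas \<alpha> w B / emeasure (mu_alpha \<alpha>) B)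
       * epow (wdual_meas \<alpha> p w B / emeasure (mu_alpha \<alpha>) B) (p_avg \<alpha> p B - 1)
     \<le> ennreal C)"

end

(*
  Write W = w(B), W' = w'(B) and m = mu_alpha(B).  All three conditions turn out to say that
  m^(-p_B) W W'^(p_B - 1) is bounded over the pseudo-balls.  Each of them, applied to the whole
  unit ball, makes W and W' bounded.  A pointwise inequality between w and w' then bounds W and W'
  below by powers of m, and m is bounded below by a power of r for B = B(z,r), so that |ln W| and
  |ln W'| are O(ln (e + 1/r)).  As p oscillates on B by O(1 / ln (e + 1/r)), the exponent is constant
  up to bounded factors, i.e. a variable-exponent norm with modular X is comparable to X^q for the
  corresponding averaged exponent q.
*)

theory Submission
  imports Defs
begin

text \<open>The obstacle is that w(B) and w'(B) may be infinite, so each condition must itself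
  supply the bounds. Over the unit ball, itself a pseudo-ball, no factor of the three products
  vanishes: w is not a.e. zero, and a negative power of a non-negative number is never 0. A finite
  product of nonzero factors then has finite factors.

  The lower bounds avoid Hoelder's inequality, which would be stated in the very norms to be
  estimated. Instead, for every s in (0,1], both 1 <= s w' + s^(-p1) w and 1 <= s w + s^(-1/(p0-1))
  w' hold a.e., where p0 and p1 bound p; with s proportional to m, the bounded mass of the first
  term is absorbed.

  The averaged exponents 1/p_B, 1 - 1/p_B and p_B - 1 come from replacing p by p_B in 1/p, 1/p' and
  p/p'. Hence the product in \<open>class_B\<close> is comparable to the p_B-th root of m^(-p_B) W
  W'^(p_B - 1), the one in \<open>class_B_plus\<close> to this quantity itself, and the one in
  \<open>class_B_plus_plus\<close> equals it. As 1 < p_B <= p1, taking the root does not affect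
  boundedness.\<close>

lemma sets_mu_alpha [simp, measurable_cong]: "sets (mu_alpha \<alpha>) = sets borel"
  by (simp add: mu_alpha_def)

lemma space_mu_alpha [simp]: "space (mu_alpha \<alpha>) = UNIV"
  by (simp add: mu_alpha_def)

section \<open>Hermitian product, pseudo-distance and pseudo-balls\<close>

lemma Re_cinner: "Re (cinner z w) = inner z w"
  by (simp add: cinner_def inner_vec_def inner_complex_def)

lemma norm_cinner_le: "cmod (cinner z w) \<le> norm z * norm w"
proof -
  have "cmod (cinner z w) \<le> (\<Sum>i\<in>UNIV. cmod (z$i) * cmod (w$i))"
    unfolding cinner_def by (rule order_trans[OF norm_sum]) (simp add: norm_mult)
  also have "\<dots> \<le> norm z * norm w"
    using L2_set_mult_ineq[of "\<lambda>i. cmod (z$i)" "\<lambda>i. cmod (w$i)" UNIV]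
    by (simp add: norm_vec_def)
  finally show ?thesis .
qed

lemma cinner_self: "cinner z z = of_real ((norm z)\<^sup>2)"
proof (rule complex_eqI)
  show "Re (cinner z z) = Re (of_real ((norm z)\<^sup>2))"
    by (simp add: Re_cinner power2_norm_eq_inner)
  show "Im (cinner z z) = Im (of_real ((norm z)\<^sup>2))"
    by (simp add: cinner_def)
qed

lemma cinner_diff_right: "cinner z (v - w) = cinner z v - cinner z w"
  by (simp add: cinner_def algebra_simps sum_subtractf)

lemma cinner_scaleR_left: "cinner (c *\<^sub>R z) w = of_real c * cinner z w"
  by (simp add: cinner_def sum_distrib_left scaleR_conv_of_real[where 'a=complex] mult.assoc)

lemma cinner_scaleR_right: "cinner z (c *\<^sub>R w) = of_real c * cinner z w"
  by (simp add: cinner_def sum_distrib_left scaleR_conv_of_real[where 'a=complex] mult_ac)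

text \<open>The angular term vanishes only if \<open>cinner z \<zeta>\<close> is the product of the
  norms. Its real part is the Euclidean inner product, so this is the equality case of
  Cauchy-Schwarz, and equal norms then force equal points. Positivity ensures that
  \<open>1 / pdist z \<zeta>\<close> is a genuine reciprocal in the log-Hoelder condition.\<close>

lemma pdist_pos:
  assumes "z \<noteq> \<zeta>"
  shows "pdist z \<zeta> > 0"
proof (cases "z \<noteq> 0 \<and> \<zeta> \<noteq> 0")
  case False
  then show ?thesis
    using assms by (auto simp: pdist_def)
next
  case True
  show ?thesis
  proof (rule ccontr)
    assume "\<not> pdist z \<zeta> > 0"
    then have n: "norm z = norm \<zeta>"
      and c: "cmod (1 - cinner z \<zeta> / of_real (norm z * norm \<zeta>)) = 0"
      using True unfolding pdist_def
      by (smt (verit) abs_ge_zero norm_ge_zero)+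
    from c True have "cinner z \<zeta> = of_real (norm z * norm \<zeta>)"
      by simp
    then have "inner z \<zeta> = norm z * norm \<zeta>"
      by (metis Re_cinner Re_complex_of_real)
    then have "norm z *\<^sub>R \<zeta> = norm \<zeta> *\<^sub>R z"
      by (simp add: norm_cauchy_schwarz_eq)
    with n True assms show False
      by simp
  qed
qed

lemma pdist_measurable [measurable]: "pdist z \<in> borel_measurable borel"
proof -
  have [measurable]: "cinner z \<in> borel_measurable borel"
    unfolding cinner_def[abs_def]
    by (intro borel_measurable_continuous_onI continuous_intros)
  show ?thesis
    unfolding pdist_def[abs_def] by measurable
qed

lemma pball_in_sets [measurable]: "pball z r \<in> sets (mu_alpha \<alpha>)"
proof -
  have "pball z r = unit_ball \<inter> {\<zeta> \<in> space borel. pdist z \<zeta> < r}"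
    by (auto simp: pball_def)
  then show ?thesis
    by simp
qed

section \<open>The measure \<open>mu_alpha\<close> and its finiteness\<close>

lemma emeasure_mu_alpha:
  assumes "E \<in> sets borel"
  shows "emeasure (mu_alpha \<alpha> :: (complex^'n) measure) E =
    (\<integral>\<^sup>+z. indicator (E \<inter> ball 0 1) z * ennreal ((1 - (norm z)\<^sup>2) powr (\<alpha> - 1)
       / measure lborel (ball (0::complex^'n) 1)) \<partial>lborel)"
  unfolding mu_alpha_def using assms
  by (subst emeasure_density)
    (auto intro!: nn_integral_cong simp: indicator_def split: if_splits)

lemma AE_mu_alpha_ball: "AE z in mu_alpha \<alpha>. z \<in> unit_ball"
  unfolding mu_alpha_def by (subst AE_density) (auto simp: indicator_def split: if_splits)

lemma unit_ball_in_pballs: "unit_ball \<in> pballs"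
proof -
  have "unit_ball = pball 0 2"
    by (auto simp: pball_def pdist_def)
  then show ?thesis
    unfolding pballs_def by (intro CollectI exI[of _ 0] exI[of _ 2]) auto
qed

text \<open>Bernoulli's inequality makes the volume of a shell linear in its thickness. This one
  power of \<open>t\<close> is what compensates for the growth of the density at the sphere when
  \<alpha> < 1.\<close>

lemma emeasure_annulus_le:
  fixes t :: real
  assumes "0 \<le> t" "t \<le> 1"
  shows "emeasure lborel (ball 0 1 - ball (0::'a::euclidean_space) (1 - t))
    \<le> ennreal (unit_ball_vol DIM('a) * DIM('a) * t)"
proof -
  have "emeasure lborel (ball 0 1 - ball (0::'a) (1 - t)) =
      emeasure lborel (ball (0::'a) 1) - emeasure lborel (ball (0::'a) (1 - t))"
    using assms by (intro emeasure_Diff) (auto simp: emeasure_ball)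
  also have "\<dots> = ennreal (unit_ball_vol DIM('a) * (1 - (1 - t) ^ DIM('a)))"
    using assms by (simp add: emeasure_ball ennreal_minus algebra_simps)
  also have "\<dots> \<le> ennreal (unit_ball_vol DIM('a) * (DIM('a) * t))"
    using Bernoulli_inequality[of "-t" "DIM('a)"] assms
    by (intro ennreal_leI mult_left_mono) auto
  finally show ?thesis
    by (simp add: mult.assoc)
qed

text \<open>For \<alpha> < 1 the density is unbounded near the sphere. At distance about 2^(-k) from
  it the density is of order 2^(-k(\<alpha>-1)), and such points fill a volume of order 2^(-k); the
  resulting series is geometric with ratio 2^(-\<alpha>), which is where \<alpha> > 0
  enters.\<close>

lemma finite_measure_mu_alpha:
  fixes \<alpha> :: real
  assumes "\<alpha> > 0"
  shows "finite_measure (mu_alpha \<alpha> :: (complex^'n) measure)"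
proof -
  let ?v = "measure lborel (ball (0::complex^'n) 1)"
  let ?d = "DIM(complex^'n)"
  let ?A = "\<lambda>k. ball 0 1 - ball (0::complex^'n) (1 - (1/2)^k)"
  \<comment> \<open>\<open>a k\<close> bounds the power of 1 - |z|^2 where 1 - |z| lies in
    (2^(-k-1), 2^(-k)]: the summand 1 serves \<alpha> \<ge> 1, the other one \<alpha> < 1. The sets
    \<open>?A k\<close> are nested rather than disjoint, which is harmless, since a single term of
    the series already dominates the density at a given point.\<close>
  define a where "a k = 1 + (1/2::real) powr ((real k + 1) * (\<alpha> - 1))" for k
  have v: "?v > 0"
    by (simp add: content_ball_pos)
  have fbound: "indicator (ball 0 1) z * ennreal ((1 - (norm z)\<^sup>2) powr (\<alpha> - 1) / ?v)
      \<le> (\<Sum>k. indicator (?A k) z * ennreal (a k / ?v))" for z :: "complex^'n"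
  proof (cases "z \<in> ball 0 1")
    case True
    define x where "x = 1 - norm z"
    have x: "0 < x" "x \<le> 1"
      using True by (auto simp: x_def)
    obtain k0 where "(1/2)^k0 < x"
      using real_arch_pow_inv[of x "1/2"] x by auto
    define k where "k = (LEAST k. (1/2)^Suc k < x)"
    have "(1/2)^Suc k0 < x"
      using \<open>(1/2)^k0 < x\<close> x by simp
    then have k1: "(1/2)^Suc k < x"
      unfolding k_def by (rule LeastI)
    have k2: "x \<le> (1/2)^k"
    proof (cases k)
      case 0
      then show ?thesis using x by simp
    next
      case (Suc j)
      then show ?thesis
        using not_less_Least[of j "\<lambda>k. (1/2)^Suc k < x"] by (auto simp: k_def not_less)
    qed
    have zA: "z \<in> ?A k"
      using True k2 by (auto simp: x_def)
    define y where "y = 1 - (norm z)\<^sup>2"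
    have y: "x \<le> y" "y \<le> 1"
      using True by (auto simp: x_def y_def power2_eq_square mult_left_le)
    have "y powr (\<alpha> - 1) \<le> a k"
    proof (cases "\<alpha> \<ge> 1")
      case True
      then have "y powr (\<alpha> - 1) \<le> 1 powr (\<alpha> - 1)"
        using x y by (intro powr_mono2) auto
      then show ?thesis
        by (simp add: a_def add_increasing2)
    next
      case False
      have "y powr (\<alpha> - 1) \<le> ((1/2)^Suc k) powr (\<alpha> - 1)"
        using False x y k1 by (intro powr_mono2') auto
      also have "\<dots> = (1/2) powr ((real k + 1) * (\<alpha> - 1))"
        by (simp only: powr_powr[symmetric]) (subst powr_realpow[symmetric], auto simp: add_ac)
      finally show ?thesis
        by (simp add: a_def)
    qed
    then have "indicator (ball 0 1) z * ennreal ((1 - (norm z)\<^sup>2) powr (\<alpha> - 1) / ?v)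
        \<le> indicator (?A k) z * ennreal (a k / ?v)"
      using True zA v by (auto simp: y_def intro!: ennreal_leI divide_right_mono)
    also have "\<dots> \<le> (\<Sum>k. indicator (?A k) z * ennreal (a k / ?v))"
      using sum_le_suminf[of "\<lambda>k. indicator (?A k) z * ennreal (a k / ?v)" "{k}"]
      by (simp only: summableI sum.insert finite.intros sum.empty empty_iff not_False_eq_True add_0_right)
        simp
    finally show ?thesis .
  qed auto
  have "emeasure (mu_alpha \<alpha> :: (complex^'n) measure) UNIV
      \<le> (\<integral>\<^sup>+z. (\<Sum>k. indicator (?A k) z * ennreal (a k / ?v)) \<partial>lborel)"
    by (subst emeasure_mu_alpha) (auto intro!: nn_integral_mono simp: fbound)
  also have "\<dots> = (\<Sum>k. ennreal (a k / ?v) * emeasure lborel (?A k))"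
  proof (subst nn_integral_suminf)
    fix k
    have A: "?A k \<in> sets lborel"
      by auto
    then show "(\<lambda>z. indicator (?A k) z * ennreal (a k / ?v)) \<in> borel_measurable lborel"
      by (intro borel_measurable_times_ennreal borel_measurable_indicator borel_measurable_const)
  next
    have "(\<integral>\<^sup>+z. indicator (?A k) z * ennreal (a k / ?v) \<partial>lborel) = ennreal (a k / ?v) * emeasure lborel (?A k)" for k
      by (simp only: mult.commute[of "indicator _ _"]) (rule nn_integral_cmult_indicator, auto)
    then show "(\<Sum>k. \<integral>\<^sup>+z. indicator (?A k) z * ennreal (a k / ?v) \<partial>lborel) =
        (\<Sum>k. ennreal (a k / ?v) * emeasure lborel (?A k))"
      by (simp only:)
  qed
  also have "\<dots> \<le> (\<Sum>k. ennreal (?d * (a k * (1/2)^k)))"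
  proof (intro suminf_le allI)
    fix k
    have v': "?v = unit_ball_vol ?d"
      by (simp add: content_ball)
    have "ennreal (a k / ?v) * emeasure lborel (?A k) \<le>
       ennreal (a k / ?v) * ennreal (unit_ball_vol ?d * ?d * (1/2)^k)"
      by (intro mult_left_mono emeasure_annulus_le) (auto simp: power_le_one)
    also have "\<dots> = ennreal (?d * (a k * (1/2)^k))"
    proof -
      have "a k / ?v * (?v * ?d * (1/2)^k) = ?d * (a k * (1/2)^k)"
        using v by simp
      then show ?thesis
        unfolding v'[symmetric] by (subst ennreal_mult[symmetric]) (auto simp: a_def)
    qed
    finally show "ennreal (a k / ?v) * emeasure lborel (?A k) \<le> ennreal (?d * (a k * (1/2)^k))" .
  qed auto
  also have "\<dots> < \<infinity>"
  proof -
    have "a k * (1/2)^k = (1/2)^k + (1/2) powr (\<alpha> - 1) * ((1/2) powr \<alpha>)^k" for k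
    proof -
      have "(1/2::real) powr ((real k + 1) * (\<alpha> - 1)) * (1/2)^k =
         (1/2) powr ((real k + 1) * (\<alpha> - 1) + real k)"
        by (simp add: powr_add powr_realpow)
      also have "(real k + 1) * (\<alpha> - 1) + real k = (\<alpha> - 1) + \<alpha> * real k"
        by (simp add: algebra_simps)
      also have "(1/2::real) powr \<dots> = (1/2) powr (\<alpha> - 1) * ((1/2) powr \<alpha>)^k"
        by (simp add: powr_add powr_powr[symmetric] powr_realpow)
      finally show ?thesis
        by (simp add: a_def algebra_simps)
    qed
    moreover have "(1/2::real) powr \<alpha> < 1"
      using assms by (simp add: powr01_less_one)
    ultimately have "summable (\<lambda>k. ?d * (a k * (1/2)^k))"
      by (auto intro!: summable_mult summable_add summable_geometric)
    then show ?thesis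
      by (subst suminf_ennreal2) (auto simp: a_def)
  qed
  finally show ?thesis
    by (intro finite_measureI) (simp add: less_top)
qed


section \<open>Powers with values in [0, infinity] and Luxemburg norms\<close>

lemma epow_zero [simp]: "epow 0 e = 0"
  by (simp add: epow_def)

lemma epow_indicator: "epow (indicator B z * x) e = indicator B z * epow x e"
  by (auto simp: indicator_def)

lemma epow_divide:
  assumes "l > 0"
  shows "epow (x / ennreal l) e = epow x e * ennreal (l powr (- e))"
proof (cases x)
  case (real r)
  then show ?thesis
    using assms
    by (auto simp: epow_def divide_ennreal powr_divide powr_minus_divide
        ennreal_mult[symmetric] ennreal_top_neq_zero)
next
  case top
  then show ?thesis
    using assms by (auto simp: epow_def ennreal_top_divide ennreal_top_mult)
qed

lemma epow_measurable [measurable]: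
  assumes [measurable]: "f \<in> borel_measurable M" "r \<in> borel_measurable M"
  shows "(\<lambda>z. epow (f z) (r z)) \<in> borel_measurable M"
  unfolding epow_def by measurable

lemma wpow_measurable [measurable]:
  assumes [measurable]: "f \<in> borel_measurable M" "r \<in> borel_measurable M"
  shows "(\<lambda>z. wpow (f z) (r z)) \<in> borel_measurable M"
  unfolding wpow_def by measurable

lemma conj_exp_measurable [measurable]:
  assumes [measurable]: "p \<in> borel_measurable M"
  shows "conj_exp p \<in> borel_measurable M"
  unfolding conj_exp_def[abs_def] by measurable

lemma epow_wpow_inverse:
  assumes "x \<ge> 0" "e > 1"
  shows "epow (wpow x (1 / e)) e = ennreal x"
  using assms by (auto simp: epow_def wpow_def powr_powr)

text \<open>The exponents multiply to -p'/p = 1 - p', the exponent of the dual weight. At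
  \<open>x = 0\<close> both sides are infinite because 1 - p' is negative. In the same way w^(-1)
  raised to p'/p gives w', so two different norms share the modular w'(B).\<close>

lemma epow_wpow_neg_inverse:
  assumes "x \<ge> 0" "p z > 1"
  shows "epow (wpow x (- 1 / p z)) (conj_exp p z) = wpow x (1 - conj_exp p z)"
proof -
  have "- 1 / p z * conj_exp p z = 1 - conj_exp p z" "1 - conj_exp p z < 0"
    using assms by (auto simp: conj_exp_def field_simps)
  then show ?thesis
    using assms by (auto simp: epow_def wpow_def powr_powr)
qed

lemma epow_wpow_neg_one:
  assumes "x \<ge> 0" "p z > 1"
  shows "epow (wpow x (- 1)) (conj_exp p z / p z) = wpow x (1 - conj_exp p z)"
proof -
  have e: "- 1 * (conj_exp p z / p z) = 1 - conj_exp p z" and "1 - conj_exp p z < 0"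
    using assms by (auto simp: conj_exp_def field_simps)
  moreover have "(x powr - 1) powr (conj_exp p z / p z) = x powr (1 - conj_exp p z)"
    by (simp only: powr_powr e)
  ultimately show ?thesis
    using assms by (cases "x = 0") (simp_all add: epow_def wpow_def powr_powr del: powr_neg_one)
qed

lemma vnorm_le:
  assumes "l > 0" "(\<integral>\<^sup>+ z. epow (f z / ennreal l) (r z) \<partial>mu_alpha \<alpha>) \<le> 1"
  shows "vnorm \<alpha> r f \<le> ennreal l"
  unfolding vnorm_def using assms by (intro Inf_lower) auto

lemma vnorm_ge:
  assumes "\<And>l. l > 0 \<Longrightarrow> (\<integral>\<^sup>+ z. epow (f z / ennreal l) (r z) \<partial>mu_alpha \<alpha>) \<le> 1 \<Longrightarrow> c \<le> ennreal l"
  shows "c \<le> vnorm \<alpha> r f"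
  unfolding vnorm_def using assms by (intro Inf_greatest) auto

text \<open>As the exponent is at most \<open>b\<close>, dividing by \<open>l\<close> changes the
  integrand at most by the constant factor \<open>max 1 l powr b\<close>. No rescaling can therefore
  make an infinite modular finite.\<close>

lemma vnorm_eq_top:
  assumes [measurable]: "f \<in> borel_measurable (mu_alpha \<alpha>)" "r \<in> borel_measurable (mu_alpha \<alpha>)"
    and r: "AE z in mu_alpha \<alpha>. 0 \<le> r z \<and> r z \<le> b"
    and top: "(\<integral>\<^sup>+ z. epow (f z) (r z) \<partial>mu_alpha \<alpha>) = \<infinity>"
  shows "vnorm \<alpha> r f = \<infinity>"
proof -
  have "\<infinity> \<le> vnorm \<alpha> r f"
  proof (rule vnorm_ge)
    fix l :: real assume l: "l > 0" "(\<integral>\<^sup>+ z. epow (f z / ennreal l) (r z) \<partial>mu_alpha \<alpha>) \<le> 1"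
    define m where "m = max 1 l"
    have "(\<integral>\<^sup>+ z. epow (f z) (r z) \<partial>mu_alpha \<alpha>)
        \<le> (\<integral>\<^sup>+ z. epow (f z / ennreal l) (r z) * ennreal (m powr b) \<partial>mu_alpha \<alpha>)"
    proof (rule nn_integral_mono_AE, use r in eventually_elim)
      case (elim z)
      have "l powr r z \<le> m powr r z"
        using l elim by (intro powr_mono2) (auto simp: m_def)
      also have "\<dots> \<le> m powr b"
        using elim by (intro powr_mono) (auto simp: m_def)
      finally have "1 \<le> l powr (- r z) * m powr b"
        using l by (simp add: powr_minus field_simps)
      then have "ennreal 1 \<le> ennreal (l powr (- r z) * m powr b)"
        by (rule ennreal_leI)
      then have "epow (f z) (r z) * 1 \<le> epow (f z) (r z) * (ennreal (l powr (- r z)) * ennreal (m powr b))"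
        by (intro mult_left_mono) (auto simp: ennreal_mult)
      then show ?case
        using l by (simp add: epow_divide mult.assoc)
    qed
    also have "\<dots> = (\<integral>\<^sup>+ z. epow (f z / ennreal l) (r z) \<partial>mu_alpha \<alpha>) * ennreal (m powr b)"
      by (rule nn_integral_multc) measurable
    also have "\<dots> \<le> 1 * ennreal (m powr b)"
      by (intro mult_right_mono l) auto
    finally have "(\<infinity>::ennreal) \<le> 1 * ennreal (m powr b)"
      by (simp add: top)
    then show "(\<infinity>::ennreal) \<le> ennreal l"
      by (simp add: top_unique)
  qed
  then show ?thesis
    by (simp add: top_unique)
qed

text \<open>The candidate for the norm is X^q: its power r(z) is X * X^(q r(z) - 1), and the
  hypothesis places the last factor between exp(-C) and exp C. Thus dividing by X^q brings the
  modular to 1 up to bounded factors. Since r \<ge> a, a factor exp(C/a) in the norm is enough to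
  pay for exp C in the modular.\<close>

lemma vnorm_bounds:
  assumes [measurable]: "f \<in> borel_measurable (mu_alpha \<alpha>)" "r \<in> borel_measurable (mu_alpha \<alpha>)"
    and a: "a > 0" and C: "C \<ge> 0" and X: "X > 0"
    and r: "AE z in mu_alpha \<alpha>. f z \<noteq> 0 \<longrightarrow> a \<le> r z \<and> \<bar>ln X\<bar> * \<bar>q * r z - 1\<bar> \<le> C"
    and int: "(\<integral>\<^sup>+ z. epow (f z) (r z) \<partial>mu_alpha \<alpha>) = ennreal X"
  shows "vnorm \<alpha> r f \<le> ennreal (exp (C / a) * X powr q)"
    and "ennreal (exp (- (C / a)) * X powr q) \<le> vnorm \<alpha> r f"
proof -
  have dev: "exp (- C) * X \<le> X powr (q * s)" "X powr (q * s) \<le> exp C * X"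
    if "\<bar>ln X\<bar> * \<bar>q * s - 1\<bar> \<le> C" for s
  proof -
    have "\<bar>(q * s - 1) * ln X\<bar> \<le> C"
      using that by (simp add: abs_mult mult.commute)
    then have "- C + ln X \<le> q * s * ln X" and "q * s * ln X \<le> C + ln X"
      by (auto simp: algebra_simps abs_le_iff)
    then have "exp (- C + ln X) \<le> exp (q * s * ln X)" and "exp (q * s * ln X) \<le> exp (C + ln X)"
      by (simp_all only: exp_le_cancel_iff)
    then show "exp (- C) * X \<le> X powr (q * s)" "X powr (q * s) \<le> exp C * X"
      unfolding powr_def using X by (simp_all only: exp_add exp_ln less_irrefl if_False split: if_splits) auto
  qed
  show "vnorm \<alpha> r f \<le> ennreal (exp (C / a) * X powr q)"
  proof (rule vnorm_le)
    let ?l = "exp (C / a) * X powr q"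
    show l: "?l > 0" using X by simp
    have "(\<integral>\<^sup>+ z. epow (f z / ennreal ?l) (r z) \<partial>mu_alpha \<alpha>)
       \<le> (\<integral>\<^sup>+ z. epow (f z) (r z) * ennreal (1 / X) \<partial>mu_alpha \<alpha>)"
    proof (rule nn_integral_mono_AE, use r in eventually_elim)
      case (elim z)
      show ?case
      proof (cases "f z = 0")
        case False
        with elim have e: "a \<le> r z" "\<bar>ln X\<bar> * \<bar>q * r z - 1\<bar> \<le> C" by auto
        have "X = exp C * (exp (- C) * X)"
          by (simp add: exp_minus)
        also have "\<dots> \<le> exp (C / a * r z) * X powr (q * r z)"
          using dev(1)[OF e(2)] a C e(1) X
          by (intro mult_mono) (auto simp: field_simps mult_left_mono)
        also have "\<dots> = ?l powr r z"
          by (simp add: powr_mult powr_powr exp_powr_real)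
        finally have "?l powr (- r z) \<le> 1 / X"
          using X l by (simp only: powr_minus_divide) (intro divide_left_mono, auto)
        then show ?thesis
          using l by (simp only: epow_divide) (intro mult_left_mono ennreal_leI, auto)
      qed simp
    qed
    also have "\<dots> = ennreal X * ennreal (1 / X)"
      by (subst nn_integral_multc) (auto simp: int)
    also have "\<dots> = 1"
      using X by (simp add: ennreal_mult[symmetric])
    finally show "(\<integral>\<^sup>+ z. epow (f z / ennreal ?l) (r z) \<partial>mu_alpha \<alpha>) \<le> 1" .
  qed
  show "ennreal (exp (- (C / a)) * X powr q) \<le> vnorm \<alpha> r f"
  proof (rule vnorm_ge)
    let ?L = "exp (- (C / a)) * X powr q"
    have L: "?L > 0" using X by simp
    fix l :: real assume l: "l > 0" "(\<integral>\<^sup>+ z. epow (f z / ennreal l) (r z) \<partial>mu_alpha \<alpha>) \<le> 1"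
    show "ennreal ?L \<le> ennreal l"
    proof (rule ccontr)
      assume "\<not> ?thesis"
      then have lL: "l < ?L"
        by (meson ennreal_leI not_le)
      \<comment> \<open>\<open>t\<close> measures by how much \<open>l\<close> undercuts the claimed
        bound. The modular at \<open>l\<close> is then at least t^(-a), which exceeds 1 because t <
        1 and a > 0.\<close>
      define t where "t = l / ?L"
      have t: "0 < t" "t < 1" "l = t * ?L"
        using lL L l by (auto simp: t_def divide_less_eq)
      have "(\<integral>\<^sup>+ z. epow (f z) (r z) * ennreal (1 / (t powr a * X)) \<partial>mu_alpha \<alpha>)
         \<le> (\<integral>\<^sup>+ z. epow (f z / ennreal l) (r z) \<partial>mu_alpha \<alpha>)"
      proof (rule nn_integral_mono_AE, use r in eventually_elim)
        case (elim z)
        show ?case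
        proof (cases "f z = 0")
          case False
          with elim have e: "a \<le> r z" "\<bar>ln X\<bar> * \<bar>q * r z - 1\<bar> \<le> C" by auto
          have "l powr r z = t powr r z * (exp (- (C / a * r z)) * X powr (q * r z))"
            by (simp add: t(3) powr_mult powr_powr exp_powr_real)
          also have "\<dots> \<le> t powr a * (exp (- C) * (exp C * X))"
            using dev(2)[OF e(2)] a C e(1) X t
            by (intro mult_mono powr_mono') (auto simp: field_simps mult_left_mono)
          also have "\<dots> = t powr a * X"
            by (simp add: exp_minus)
          finally have "1 / (t powr a * X) \<le> l powr (- r z)"
            using X t l by (simp only: powr_minus_divide) (intro divide_left_mono, auto)
          then show ?thesis
            using l by (simp only: epow_divide) (intro mult_left_mono ennreal_leI, auto)
        qed simp
      qed
      also have "(\<integral>\<^sup>+ z. epow (f z) (r z) * ennreal (1 / (t powr a * X)) \<partial>mu_alpha \<alpha>) =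
          ennreal X * ennreal (1 / (t powr a * X))"
        by (subst nn_integral_multc) (auto simp: int)
      also have "\<dots> = ennreal (1 / t powr a)"
        using X by (simp add: ennreal_mult[symmetric])
      finally have "ennreal (1 / t powr a) \<le> ennreal 1"
        using l(2) unfolding ennreal_1 by (rule order_trans)
      then have "1 / t powr a \<le> 1"
        by (subst (asm) ennreal_le_iff) auto
      moreover have "t powr a < 1"
        using t a by (simp add: powr01_less_one)
      ultimately show False
        using t by (simp add: field_simps)
    qed
  qed
qed


section \<open>Lower bound for the measure of a pseudo-ball\<close>

lemma ln_exp1_plus_ge_1:
  assumes "x \<ge> 0"
  shows "1 \<le> ln (exp 1 + x :: real)"
  using assms by (subst ln_ge_iff) (auto intro: add_pos_nonneg)

text \<open>The centre lies in the direction of \<open>z\<close> at depth \<rho>/2 below the sphere.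
  A point at Euclidean distance \<delta> from it has radial term below \<rho>/2 + \<delta> and
  angular term at most 4 \<delta>, for \<open>z\<close> nonzero; the radius \<rho>/10 is chosen so
  that \<rho>/2 + 5 \<delta> stays below \<rho>.\<close>

lemma inner_ball_subset_pball:
  fixes z u :: "complex^'n"
  assumes z: "z \<in> unit_ball" and r: "r > 1 - norm z" and u: "norm u = 1" "z = norm z *\<^sub>R u"
    and \<rho>: "\<rho> = min r 1" and \<zeta>: "dist ((1 - \<rho>/2) *\<^sub>R u) \<zeta> < \<rho>/10"
  shows "\<zeta> \<in> pball z r" and "norm \<zeta> \<le> 1 - 2/5 * \<rho>"
proof -
  define t \<delta> where "t = 1 - \<rho>/2" and "\<delta> = norm (t *\<^sub>R u - \<zeta>)"
  \<comment> \<open>The strict inequality is restricted to nonzero \<open>z\<close>: at the origin r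
    > 1, hence \<rho> = 1 = 1 - |z|. That case is settled directly, the pseudo-distance being the
    norm there.\<close>
  have \<rho>': "0 < \<rho>" "\<rho> \<le> 1" "\<rho> \<le> r" "z \<noteq> 0 \<Longrightarrow> \<rho> > 1 - norm z"
    using z r \<rho> by auto
  then have t: "1/2 \<le> t" "t \<le> 1"
    by (auto simp: t_def)
  have \<delta>: "\<delta> < \<rho>/10"
    using \<zeta> by (simp add: \<delta>_def t_def dist_norm)
  have "norm (t *\<^sub>R u) = t"
    using t u by simp
  then have nt: "\<bar>norm \<zeta> - t\<bar> \<le> \<delta>"
    using norm_triangle_ineq3[of "t *\<^sub>R u" \<zeta>] by (simp add: \<delta>_def abs_minus_commute)
  then show n\<zeta>: "norm \<zeta> \<le> 1 - 2/5 * \<rho>"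
    using \<delta> by (simp add: t_def)
  have pos: "norm \<zeta> > 0"
    using nt \<delta> t \<rho>' by (auto simp only: t_def abs_le_iff)
  have "pdist z \<zeta> < r"
  proof (cases "z = 0")
    case True
    then show ?thesis
      using n\<zeta> \<rho>' r by (simp add: pdist_def)
  next
    case False
    have "cinner z \<zeta> / of_real (norm z * norm \<zeta>) = cinner u (sgn \<zeta>)"
    proof -
      have "cinner z \<zeta> = of_real (norm z) * cinner u \<zeta>"
        by (subst u(2)) (rule cinner_scaleR_left)
      then show ?thesis
        using False pos by (simp add: sgn_div_norm cinner_scaleR_right field_simps)
    qed
    moreover have "cinner u u = 1"
      using u by (simp add: cinner_self)
    ultimately have "cmod (1 - cinner z \<zeta> / of_real (norm z * norm \<zeta>)) = cmod (cinner u (u - sgn \<zeta>))"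
      by (simp add: cinner_diff_right)
    also have "\<dots> \<le> norm (u - sgn \<zeta>)"
      using norm_cinner_le[of u "u - sgn \<zeta>"] u by simp
    also have "\<dots> \<le> 4 * \<delta>"
    proof -
      \<comment> \<open>Both \<open>t *\<^sub>R u - \<zeta>\<close> and the radial correction have
        norm at most \<delta>; dividing by t \<ge> 1/2 turns 2 \<delta> into 4 \<delta>.\<close>
      have "t * norm (u - sgn \<zeta>) = norm ((t *\<^sub>R u - \<zeta>) + (norm \<zeta> - t) *\<^sub>R sgn \<zeta>)"
      proof -
        have "(t *\<^sub>R u - \<zeta>) + (norm \<zeta> - t) *\<^sub>R sgn \<zeta> = t *\<^sub>R (u - sgn \<zeta>)"
          using pos by (simp add: algebra_simps sgn_div_norm)
        then show ?thesis
          using t by simp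
      qed
      also have "\<dots> \<le> \<delta> + \<bar>norm \<zeta> - t\<bar>"
        unfolding \<delta>_def using pos by (intro order_trans[OF norm_triangle_ineq]) (simp add: norm_sgn)
      finally have "t * norm (u - sgn \<zeta>) \<le> 2 * \<delta>"
        using nt by simp
      moreover have "1/2 * norm (u - sgn \<zeta>) \<le> t * norm (u - sgn \<zeta>)"
        using t by (intro mult_right_mono) auto
      ultimately show ?thesis
        by simp
    qed
    finally have "cmod (1 - cinner z \<zeta> / of_real (norm z * norm \<zeta>)) \<le> 4 * \<delta>" .
    moreover have "\<bar>norm z - norm \<zeta>\<bar> < \<rho>/2 + \<delta>"
      \<comment> \<open>|z| lies in (1 - \<rho>, 1), and \<open>t\<close> is the midpoint of this
        interval.\<close>
      using nt \<rho>'(4)[OF False] z by (auto simp: t_def abs_le_iff abs_less_iff)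
    ultimately show ?thesis
      using False pos \<delta> \<rho>' by (simp add: pdist_def)
  qed
  then show "\<zeta> \<in> pball z r"
    using n\<zeta> \<rho>' by (simp add: pball_def)
qed

text \<open>The inner Euclidean ball has volume of order \<rho>^d, where d is the real dimension,
  and on it 1 - |\<zeta>|^2 is at least 2\<rho>/5. The exponent of \<rho> is not sharp; some fixed
  power suffices, since only logarithms of it are used.\<close>

lemma emeasure_pball_ge:
  fixes \<alpha> :: real and z :: "complex^'n"
  assumes \<alpha>: "\<alpha> > 0" and z: "z \<in> unit_ball" and r: "r > 1 - norm z"
  shows "ennreal ((2/5) powr \<alpha> * (1/10)^DIM(complex^'n) * min r 1 powr (\<alpha> + DIM(complex^'n)))
    \<le> emeasure (mu_alpha \<alpha>) (pball z r)"
proof -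
  let ?d = "DIM(complex^'n)"
  let ?v = "measure lborel (ball (0::complex^'n) 1)"
  define \<rho> where "\<rho> = min r 1"
  have \<rho>: "0 < \<rho>" "\<rho> \<le> 1"
    using z r by (auto simp: \<rho>_def)
  obtain u where u: "norm u = 1" "z = norm z *\<^sub>R u"
  proof (cases "z = 0")
    case True
    obtain u :: "complex^'n" where "norm u = 1"
      using vector_choose_size[of 1] by auto
    then show ?thesis using that True by simp
  next
    case False
    then show ?thesis using that[of "sgn z"] by (simp add: norm_sgn sgn_div_norm)
  qed
  let ?E = "ball ((1 - \<rho>/2) *\<^sub>R u) (\<rho>/10)"
  have v: "?v > 0"
    by simp
  have vol: "emeasure lborel ?E = ennreal (?v * (\<rho>/10)^?d)"
    using \<rho> by (simp add: emeasure_ball content_ball)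
  have "ennreal ((2/5) powr \<alpha> * (1/10)^?d * \<rho> powr (\<alpha> + ?d))
      = ennreal ((2/5*\<rho>) powr \<alpha> / ?v) * emeasure lborel ?E"
  proof -
    have "\<rho> powr (\<alpha> + ?d) = \<rho> powr \<alpha> * \<rho> ^ ?d"
      using \<rho> by (simp only: powr_add powr_realpow)
    then have "(2/5) powr \<alpha> * (1/10)^?d * \<rho> powr (\<alpha> + ?d) = (2/5*\<rho>) powr \<alpha> / ?v * (?v * (\<rho>/10)^?d)"
      using v \<rho> by (subst powr_mult) (auto simp: power_divide)
    then show ?thesis
      unfolding vol using v \<rho> by (simp only:) (rule ennreal_mult, auto)
  qed
  also have "\<dots> = (\<integral>\<^sup>+\<zeta>. indicator ?E \<zeta> * ennreal ((2/5*\<rho>) powr \<alpha> / ?v) \<partial>lborel)"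
    by (simp only: mult.commute[of "indicator _ _"]) (rule nn_integral_cmult_indicator[symmetric], simp)
  also have "\<dots> \<le> emeasure (mu_alpha \<alpha>) (pball z r)"
  proof (subst emeasure_mu_alpha)
    show "pball z r \<in> sets borel"
      using pball_in_sets[of z r \<alpha>] by simp
    show "(\<integral>\<^sup>+\<zeta>. indicator ?E \<zeta> * ennreal ((2/5*\<rho>) powr \<alpha> / ?v) \<partial>lborel) \<le>
      (\<integral>\<^sup>+\<zeta>. indicator (pball z r \<inter> ball 0 1) \<zeta> * ennreal ((1 - (norm \<zeta>)\<^sup>2) powr (\<alpha> - 1) / ?v) \<partial>lborel)"
    proof (rule nn_integral_mono)
      fix \<zeta> :: "complex^'n"
      show "indicator ?E \<zeta> * ennreal ((2/5*\<rho>) powr \<alpha> / ?v) \<le>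
        indicator (pball z r \<inter> ball 0 1) \<zeta> * ennreal ((1 - (norm \<zeta>)\<^sup>2) powr (\<alpha> - 1) / ?v)"
      proof (cases "\<zeta> \<in> ?E")
        case True
        note s = inner_ball_subset_pball[OF z r u \<rho>_def, of \<zeta>]
        have s1: "\<zeta> \<in> pball z r" and s2: "norm \<zeta> \<le> 1 - 2/5*\<rho>"
          using s True by (auto simp: mem_ball)
        define x where "x = 1 - (norm \<zeta>)\<^sup>2"
        have "(norm \<zeta>)\<^sup>2 \<le> norm \<zeta>"
          using s2 \<rho> by (simp add: power2_eq_square mult_left_le)
        then have x: "2/5*\<rho> \<le> x" "x \<le> 1"
          using s2 by (auto simp: x_def)
        \<comment> \<open>Passing through the exponent \<alpha>, which is positive, treats \<alpha>
          < 1 and \<alpha> \<ge> 1 alike; as x \<le> 1, lowering the exponent to \<alpha> - 1 only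
          increases the power.\<close>
        have "(2/5*\<rho>) powr \<alpha> \<le> x powr \<alpha>"
          using x \<rho> \<alpha> by (intro powr_mono2) auto
        also have "\<dots> \<le> x powr (\<alpha> - 1)"
          using x \<rho> by (intro powr_mono') auto
        finally show ?thesis
          using True s1 v by (auto simp: x_def pball_def intro!: ennreal_leI divide_right_mono)
      qed auto
    qed
  qed
  finally show ?thesis
    by (simp add: \<rho>_def)
qed

section \<open>The averaged exponent, and positivity of norms\<close>

text \<open>\<open>p_avg\<close> is a harmonic mean, and averaging the reversed bounds 1/hi \<le>
  1/p \<le> 1/lo over \<open>B\<close> confines it to the same interval as p.\<close>

lemma p_avg_bounds:
  fixes p :: "complex^'n \<Rightarrow> real"
  assumes fin: "finite_measure (mu_alpha \<alpha> :: (complex^'n) measure)" and [measurable]: "p \<in> borel_measurable (mu_alpha \<alpha>)"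
    and [measurable]: "B \<in> sets (mu_alpha \<alpha>)" and pos: "measure (mu_alpha \<alpha>) B > 0" and lo: "lo > 0"
    and p: "AE z in mu_alpha \<alpha>. z \<in> B \<longrightarrow> lo \<le> p z \<and> p z \<le> hi"
  shows "lo \<le> p_avg \<alpha> p B" and "p_avg \<alpha> p B \<le> hi"
proof -
  interpret finite_measure "mu_alpha \<alpha> :: (complex^'n) measure" by fact
  let ?m = "measure (mu_alpha \<alpha>) B"
  have "emeasure (mu_alpha \<alpha>) B \<noteq> 0"
    using pos by (auto simp: measure_def)
  \<comment> \<open>Contradictory bounds would make \<open>B\<close> a null set. This yields hi > 0,
    so that taking reciprocals reverses the inequalities.\<close>
  have hi: "hi \<ge> lo"
  proof (rule ccontr)
    assume "\<not> ?thesis"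
    with p have "AE z in mu_alpha \<alpha>. z \<notin> B"
      by (auto elim!: eventually_mono)
    then have "emeasure (mu_alpha \<alpha>) B = 0"
      using assms(3) by (subst (asm) AE_iff_measurable[where N = B]) auto
    with \<open>emeasure (mu_alpha \<alpha>) B \<noteq> 0\<close> show False by simp
  qed
  have int: "integrable (mu_alpha \<alpha>) (\<lambda>z. indicator B z *\<^sub>R (1 / p z))"
  proof (rule integrable_const_bound[where B = "1 / lo"])
    show "AE z in mu_alpha \<alpha>. norm (indicator B z *\<^sub>R (1 / p z)) \<le> 1 / lo"
      using p by eventually_elim (use lo in \<open>auto simp: indicator_def intro!: divide_left_mono\<close>)
  qed measurable
  have cint: "integrable (mu_alpha \<alpha>) (\<lambda>z. indicator B z *\<^sub>R k)" for k :: real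
    using assms(3) by (intro integrable_scaleR_left) (auto simp: emeasure_eq_measure)
  let ?I = "\<integral>z\<in>B. 1 / p z \<partial>mu_alpha \<alpha>"
  have const: "(\<integral>z. indicator B z *\<^sub>R k \<partial>mu_alpha \<alpha>) = ?m * k" for k :: real
    by simp
  have "(\<integral>z. indicator B z *\<^sub>R (1 / hi) \<partial>mu_alpha \<alpha>) \<le> ?I"
    unfolding set_lebesgue_integral_def
  proof (rule integral_mono_AE[OF cint int])
    show "AE z in mu_alpha \<alpha>. indicator B z *\<^sub>R (1 / hi) \<le> indicator B z *\<^sub>R (1 / p z)"
      using p by eventually_elim (use lo hi in \<open>auto simp: indicator_def intro!: divide_left_mono\<close>)
  qed
  then have I1: "?m * (1 / hi) \<le> ?I"
    by (simp only: const)
  have "?I \<le> (\<integral>z. indicator B z *\<^sub>R (1 / lo) \<partial>mu_alpha \<alpha>)"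
    unfolding set_lebesgue_integral_def
  proof (rule integral_mono_AE[OF int cint])
    show "AE z in mu_alpha \<alpha>. indicator B z *\<^sub>R (1 / p z) \<le> indicator B z *\<^sub>R (1 / lo)"
      using p by eventually_elim (use lo hi in \<open>auto simp: indicator_def intro!: divide_left_mono\<close>)
  qed
  then have I2: "?I \<le> ?m * (1 / lo)"
    by (simp only: const)
  have hi0: "0 < hi" using lo hi by simp
  have "?m * (1 / hi) > 0"
    using pos hi0 by simp
  with I1 have I0: "?I > 0"
    by linarith
  have eq: "p_avg \<alpha> p B = ?m / ?I"
    by (simp add: p_avg_def)
  show "lo \<le> p_avg \<alpha> p B" "p_avg \<alpha> p B \<le> hi"
    unfolding eq using I0 I1 I2 lo hi0 by (simp_all add: field_simps)
qed

text \<open>Only positivity is wanted, so the comparison of norm and modular may be used with q = 1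
  and with a crude constant that depends on the modular \<open>X\<close> itself. An infinite modular
  gives an infinite norm.\<close>

lemma vnorm_pos:
  assumes [measurable]: "f \<in> borel_measurable (mu_alpha \<alpha>)" "r \<in> borel_measurable (mu_alpha \<alpha>)"
    and a: "a > 0" and r: "AE z in mu_alpha \<alpha>. a \<le> r z \<and> r z \<le> b"
    and int: "(\<integral>\<^sup>+ z. epow (f z) (r z) \<partial>mu_alpha \<alpha>) \<noteq> 0"
  shows "vnorm \<alpha> r f \<noteq> 0"
proof (cases "(\<integral>\<^sup>+ z. epow (f z) (r z) \<partial>mu_alpha \<alpha>)")
  case (real X)
  with int have X: "X > 0"
    by (cases "X = 0") auto
  have "ennreal (exp (- (\<bar>ln X\<bar> * (\<bar>b\<bar> + 1) / a)) * X powr 1) \<le> vnorm \<alpha> r f"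
  proof (rule vnorm_bounds(2)[OF _ _ a _ X])
    show "AE z in mu_alpha \<alpha>. f z \<noteq> 0 \<longrightarrow> a \<le> r z \<and> \<bar>ln X\<bar> * \<bar>1 * r z - 1\<bar> \<le> \<bar>ln X\<bar> * (\<bar>b\<bar> + 1)"
      using r by eventually_elim (use a in \<open>auto intro!: mult_left_mono\<close>)
  qed (use real in auto)
  moreover have "exp (- (\<bar>ln X\<bar> * (\<bar>b\<bar> + 1) / a)) * X powr 1 > 0"
    using X by simp
  ultimately show ?thesis
    by (metis ennreal_eq_0_iff le_zero_eq not_le)
next
  case top
  have "vnorm \<alpha> r f = \<infinity>"
    by (rule vnorm_eq_top[where b = b]) (use r a top in \<open>auto elim!: eventually_mono\<close>)
  then show ?thesis by simp
qed

text \<open>A substitute for Hoelder's inequality: the pointwise bound, integrated over \<open>B\<close> with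
  \<open>s\<close> proportional to the measure of \<open>B\<close>, absorbs the \<open>g\<close> term.\<close>

lemma set_nn_integral_poly_lower:
  fixes g h :: "'a \<Rightarrow> ennreal"
  assumes [measurable]: "g \<in> borel_measurable M" "h \<in> borel_measurable M" "B \<in> sets M"
    and fin: "finite_measure M"
    and pw: "\<And>s. 0 < s \<Longrightarrow> s \<le> 1 \<Longrightarrow> AE z in M. 1 \<le> ennreal s * g z + ennreal (s powr (- m)) * h z"
    and K: "(\<integral>\<^sup>+z\<in>B. g z \<partial>M) \<le> ennreal K" "measure M B \<le> K" and pos: "measure M B > 0"
  shows "ennreal (measure M B / 2 * (measure M B / (2 * K)) powr m) \<le> (\<integral>\<^sup>+z\<in>B. h z \<partial>M)"
proof (cases "\<integral>\<^sup>+z\<in>B. h z \<partial>M")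
  case (real Y)
  interpret finite_measure M by fact
  let ?m = "measure M B"
  \<comment> \<open>With this \<open>s\<close> the first term contributes at most half of the
    measure of \<open>B\<close>, leaving the other half to the \<open>h\<close> term;
    \<open>measure M B \<le> K\<close> guarantees s \<le> 1.\<close>
  define s where "s = ?m / (2 * K)"
  have K0: "K > 0" using K pos by linarith
  have s: "0 < s" "s \<le> 1"
    using K K0 pos by (auto simp: s_def field_simps)
  have "ennreal ?m = (\<integral>\<^sup>+z. indicator B z \<partial>M)"
    by (simp add: emeasure_eq_measure)
  also have "\<dots> \<le> (\<integral>\<^sup>+z. ennreal s * (g z * indicator B z) + ennreal (s powr (- m)) * (h z * indicator B z) \<partial>M)"
    by (rule nn_integral_mono_AE) (use pw[OF s] in \<open>eventually_elim, auto simp: indicator_def\<close>)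
  also have "\<dots> = ennreal s * (\<integral>\<^sup>+z\<in>B. g z \<partial>M) + ennreal (s powr (- m)) * ennreal Y"
    by (simp add: nn_integral_add nn_integral_cmult real)
  also have "\<dots> \<le> ennreal s * ennreal K + ennreal (s powr (- m)) * ennreal Y"
    by (intro add_right_mono mult_left_mono K) auto
  also have "\<dots> = ennreal (?m / 2 + s powr (- m) * Y)"
    using s K0 real by (simp add: ennreal_mult[symmetric] ennreal_plus[symmetric] s_def del: ennreal_plus)
  finally have "?m \<le> ?m / 2 + s powr (- m) * Y"
    using pos real by (subst (asm) ennreal_le_iff) (auto intro!: add_nonneg_nonneg)
  then have "?m / 2 * s powr m \<le> Y"
    using s by (simp add: powr_minus field_simps)
  then show ?thesis
    unfolding real s_def[symmetric] by (intro ennreal_leI)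
qed simp

text \<open>A quantity between a power of min r 1 and a constant has logarithm O(ln(1/r)) for small
  r and O(1) for large r; ln(e + 1/r) dominates both. The constant collects the terms of (1+m) ln
  \<mu> - ln 2 - m ln(2K), each additive constant being multiplied by \<open>L\<close>, which is at
  least 1.\<close>

lemma abs_ln_le_of_poly_bounds:
  fixes \<mu> K k :: real
  assumes \<mu>: "k * min r 1 powr N \<le> \<mu>" and k: "k > 0" and K0: "K > 0" and r: "r > 0" and N: "N \<ge> 0"
    and Y: "\<mu> / 2 * (\<mu> / (2 * K)) powr m \<le> Y" "Y \<le> K" and m: "m \<ge> 0"
  shows "\<bar>ln Y\<bar> \<le> ((1 + m) * (\<bar>ln k\<bar> + N) + ln 2 + m * \<bar>ln (2 * K)\<bar> + \<bar>ln K\<bar>) * ln (exp 1 + 1 / r)"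
proof -
  define L where "L = ln (exp 1 + 1 / r)"
  have L: "1 \<le> L"
    unfolding L_def using r by (intro ln_exp1_plus_ge_1) auto
  have "k * min r 1 powr N > 0"
    using k r by simp
  with \<mu> have \<mu>0: "\<mu> > 0" by linarith
  have "0 < \<mu> / 2 * (\<mu> / (2 * K)) powr m"
    using \<mu>0 K0 by simp
  with Y have Y0: "Y > 0" by linarith
  have "- ln (min r 1) \<le> L"
  proof -
    have "1 / min r 1 \<le> exp 1 + 1 / r"
    proof (cases "r \<le> 1")
      case False
      have "1 < exp (1::real)" by simp
      moreover have "0 < 1 / r" using r by simp
      ultimately have "1 \<le> exp 1 + 1 / r" by linarith
      then show ?thesis using False by simp
    qed auto
    then have "ln (1 / min r 1) \<le> L"
      unfolding L_def using r by (intro ln_mono) (auto intro: add_pos_pos)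
    then show ?thesis
      using r by (cases "r \<le> 1") (simp_all add: ln_div min_def)
  qed
  then have "N * (- ln (min r 1)) \<le> N * L"
    using N by (intro mult_left_mono) auto
  moreover have "\<bar>ln k\<bar> * 1 \<le> \<bar>ln k\<bar> * L"
    using L by (intro mult_left_mono) auto
  moreover have "ln k + N * ln (min r 1) \<le> ln \<mu>"
  proof -
    have "ln (k * min r 1 powr N) \<le> ln \<mu>"
      using \<mu> \<open>k * min r 1 powr N > 0\<close> by (intro ln_mono) auto
    moreover have "ln (k * min r 1 powr N) = ln k + N * ln (min r 1)"
      using k r by (subst ln_mult_pos) (auto simp: ln_powr)
    ultimately show ?thesis by simp
  qed
  ultimately have ln\<mu>: "- ln \<mu> \<le> (\<bar>ln k\<bar> + N) * L"
    by (simp add: algebra_simps)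
  have "ln (\<mu> / 2 * (\<mu> / (2 * K)) powr m) \<le> ln Y"
    using Y(1) \<mu>0 K0 by (intro ln_mono) auto
  moreover have "ln (\<mu> / 2 * (\<mu> / (2 * K)) powr m) = ln \<mu> - ln 2 + m * (ln \<mu> - ln (2 * K))"
    using \<mu>0 K0 by (simp add: ln_mult ln_div ln_powr)
  ultimately have low: "- ln Y \<le> (1 + m) * (- ln \<mu>) + ln 2 + m * ln (2 * K)"
    by (simp add: algebra_simps)
  have "(1 + m) * (- ln \<mu>) \<le> (1 + m) * ((\<bar>ln k\<bar> + N) * L)"
    using ln\<mu> m by (intro mult_left_mono) auto
  moreover have "ln 2 * 1 \<le> ln 2 * L"
    using L by (intro mult_left_mono) auto
  moreover have "m * ln (2 * K) \<le> m * \<bar>ln (2 * K)\<bar> * L"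
  proof -
    have "m * ln (2 * K) \<le> m * \<bar>ln (2 * K)\<bar> * 1"
      using m by (auto intro!: mult_left_mono)
    also have "\<dots> \<le> m * \<bar>ln (2 * K)\<bar> * L"
      using m L by (intro mult_left_mono) auto
    finally show ?thesis .
  qed
  moreover have "0 \<le> \<bar>ln K\<bar> * L"
    using L by simp
  ultimately have "- ln Y \<le> (1 + m) * ((\<bar>ln k\<bar> + N) * L) + ln 2 * L + m * \<bar>ln (2 * K)\<bar> * L + \<bar>ln K\<bar> * L"
    using low by linarith
  then have 1: "- ln Y \<le> ((1 + m) * (\<bar>ln k\<bar> + N) + ln 2 + m * \<bar>ln (2 * K)\<bar> + \<bar>ln K\<bar>) * L"
    by (simp add: algebra_simps)
  have "ln Y \<le> ln K"
    using Y(2) Y0 by (intro ln_mono) auto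
  also have "\<dots> \<le> \<bar>ln K\<bar> * 1" by simp
  also have "\<dots> \<le> ((1 + m) * (\<bar>ln k\<bar> + N) + ln 2 + m * \<bar>ln (2 * K)\<bar> + \<bar>ln K\<bar>) * L"
    using m N L by (intro mult_mono) (auto intro!: add_nonneg_nonneg)
  finally show ?thesis
    using 1 unfolding L_def by (simp add: abs_le_iff)
qed


section \<open>Modulars of the weight, and pointwise inequalities between w and w'\<close>

lemma modular_wpow_p:
  assumes "AE z in mu_alpha \<alpha>. 1 < p z" "\<And>z. 0 \<le> w z"
  shows "(\<integral>\<^sup>+z. epow (indicator B z * wpow (w z) (1 / p z)) (p z) \<partial>mu_alpha \<alpha>) = wmeas \<alpha> w B"
  unfolding wmeas_def
  by (rule nn_integral_cong_AE, use assms(1) in eventually_elim)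
    (simp add: epow_indicator epow_wpow_inverse assms(2) mult.commute)

lemma modular_wpow_conj:
  assumes "AE z in mu_alpha \<alpha>. 1 < p z" "\<And>z. 0 \<le> w z"
  shows "(\<integral>\<^sup>+z. epow (indicator B z * wpow (w z) (- 1 / p z)) (conj_exp p z) \<partial>mu_alpha \<alpha>)
    = wdual_meas \<alpha> p w B"
  unfolding wdual_meas_def
  by (rule nn_integral_cong_AE, use assms(1) in eventually_elim)
    (simp only: epow_indicator epow_wpow_neg_inverse assms(2) mult.commute)

lemma modular_wpow_neg_one:
  assumes "AE z in mu_alpha \<alpha>. 1 < p z" "\<And>z. 0 \<le> w z"
  shows "(\<integral>\<^sup>+z. epow (indicator B z * wpow (w z) (- 1)) (conj_exp p z / p z) \<partial>mu_alpha \<alpha>)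
    = wdual_meas \<alpha> p w B"
  unfolding wdual_meas_def
  by (rule nn_integral_cong_AE, use assms(1) in eventually_elim)
    (simp only: epow_indicator epow_wpow_neg_one assms(2) mult.commute)

lemma conj_exp_bounds:
  assumes "1 < p0" "p0 \<le> p z" "p z \<le> p1"
  shows "1 \<le> conj_exp p z" "conj_exp p z \<le> p1 / (p0 - 1)"
    and "1 / p1 \<le> conj_exp p z / p z" "conj_exp p z / p z \<le> 1 / (p0 - 1)"
proof -
  have "p z / (p z - 1) \<le> p1 / (p0 - 1)"
    using assms by (intro frac_le) auto
  then show "conj_exp p z \<le> p1 / (p0 - 1)"
    by (simp add: conj_exp_def)
  have "conj_exp p z / p z = 1 / (p z - 1)"
    using assms by (simp add: conj_exp_def)
  moreover have "1 / p1 \<le> 1 / (p z - 1)" "1 / (p z - 1) \<le> 1 / (p0 - 1)"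
    using assms by (auto intro!: divide_left_mono)
  ultimately show "1 / p1 \<le> conj_exp p z / p z" "conj_exp p z / p z \<le> 1 / (p0 - 1)"
    by simp_all
qed (use assms in \<open>auto simp: conj_exp_def field_simps\<close>)

text \<open>At the threshold x = s^p1 one term takes over from the other. Above it the second term
  is at least 1; below it x^(-1/(p-1)) \<ge> s^(-p1/(p-1)) \<ge> 1/s, because p - 1 < p1 and s \<le>
  1. At x = 0 the first term is infinite.\<close>

lemma weight_sum_ge_1:
  assumes x: "0 \<le> x" and s: "0 < s" "s \<le> 1" and p: "1 < p z" "p z \<le> p1"
  shows "1 \<le> ennreal s * wpow x (1 - conj_exp p z) + ennreal (s powr (- p1)) * ennreal x"
proof (cases "s powr p1 \<le> x")
  case True
  then have "1 \<le> s powr (- p1) * x"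
    using s by (simp add: powr_minus field_simps)
  then have "ennreal 1 \<le> ennreal (s powr (- p1)) * ennreal x"
    using x by (simp only: ennreal_mult[symmetric] powr_ge_zero) (rule ennreal_leI)
  then show ?thesis
    by (simp add: add_increasing)
next
  case False
  have e: "1 - conj_exp p z = - 1 / (p z - 1)"
    using p by (simp add: conj_exp_def field_simps)
  show ?thesis
  proof (cases "x = 0")
    case True
    then show ?thesis
      using s p by (simp add: e wpow_def ennreal_mult_top)
  next
    case x0: False
    have "1 / s = s powr (- 1)"
      using s by (simp add: powr_minus_divide)
    also have "\<dots> \<le> s powr (p1 * (- 1 / (p z - 1)))"
      using s p by (intro powr_mono') (auto simp: field_simps)
    also have "\<dots> = (s powr p1) powr (- 1 / (p z - 1))"
      by (simp add: powr_powr)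
    also have "\<dots> \<le> x powr (- 1 / (p z - 1))"
      using False x x0 p by (intro powr_mono2') auto
    finally have "1 \<le> s * x powr (- 1 / (p z - 1))"
      using s by (simp add: field_simps)
    then have "ennreal 1 \<le> ennreal s * ennreal (x powr (- 1 / (p z - 1)))"
      using s by (simp only: ennreal_mult[symmetric] powr_ge_zero less_imp_le) (rule ennreal_leI)
    then show ?thesis
      using x0 by (simp add: e wpow_def add_increasing2)
  qed
qed

text \<open>Here the threshold is x = 1/s: below it x^(-1/(p-1)) \<ge> s^(1/(p-1)) \<ge>
  s^(1/(p0-1)), which uses the lower bound of p where the companion inequality uses the upper
  one.\<close>

lemma dual_weight_sum_ge_1:
  assumes x: "0 \<le> x" and s: "0 < s" "s \<le> 1" and p: "1 < p0" "p0 \<le> p z"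
  shows "1 \<le> ennreal s * ennreal x + ennreal (s powr (- (1 / (p0 - 1)))) * wpow x (1 - conj_exp p z)"
proof (cases "1 / s \<le> x")
  case True
  then have "1 \<le> s * x"
    using s by (simp add: field_simps)
  then have "ennreal 1 \<le> ennreal s * ennreal x"
    using x s by (simp only: ennreal_mult[symmetric] less_imp_le) (rule ennreal_leI)
  then show ?thesis
    by (simp add: add_increasing2)
next
  case False
  have e: "1 - conj_exp p z = - 1 / (p z - 1)"
    using p by (simp add: conj_exp_def field_simps)
  show ?thesis
  proof (cases "x = 0")
    case True
    then show ?thesis
      using s p by (simp add: e wpow_def ennreal_mult_top)
  next
    case x0: False
    have "s powr (1 / (p0 - 1)) \<le> s powr (1 / (p z - 1))"
      using s p by (intro powr_mono') (auto simp: field_simps)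
    also have "\<dots> = (1 / s) powr (- 1 / (p z - 1))"
      using s by (simp add: powr_divide powr_minus_divide)
    also have "\<dots> \<le> x powr (- 1 / (p z - 1))"
      using False x x0 p by (intro powr_mono2') auto
    finally have "1 \<le> s powr (- (1 / (p0 - 1))) * x powr (- 1 / (p z - 1))"
      using s by (simp add: powr_minus_divide[of s] pos_le_divide_eq)
    then have "ennreal 1 \<le> ennreal (s powr (- (1 / (p0 - 1)))) * ennreal (x powr (- 1 / (p z - 1)))"
      by (simp only: ennreal_mult[symmetric] powr_ge_zero) (rule ennreal_leI)
    then show ?thesis
      using x0 by (simp add: e wpow_def add_increasing)
  qed
qed


section \<open>A fixed exponent and weight: masses of the unit ball and oscillation of p\<close>

text \<open>The bound \<open>p1\<close> holds at every point of the ball since it will come from the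
  log-Hoelder condition, whereas \<open>p0\<close> reflects an essential infimum and so bounds p
  only almost everywhere.\<close>

locale weighted_log_exponent =
  fixes \<alpha> p0 p1 c :: real and p w :: "complex^'n \<Rightarrow> real"
  assumes \<alpha>: "\<alpha> > 0" and p0: "p0 > 1" and c: "c \<ge> 0"
    and p_ge: "AE z in mu_alpha \<alpha>. p0 \<le> p z"
    and p_le: "\<And>z. z \<in> unit_ball \<Longrightarrow> p z \<le> p1"
    and log_Hoelder: "\<And>z \<zeta>. z \<in> unit_ball \<Longrightarrow> \<zeta> \<in> unit_ball \<Longrightarrow> z \<noteq> \<zeta> \<Longrightarrow>
      \<bar>p z - p \<zeta>\<bar> \<le> c / ln (exp 1 + 1 / pdist z \<zeta>)"
    and p_measurable [measurable]: "p \<in> borel_measurable (mu_alpha \<alpha>)"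
    and w_measurable [measurable]: "w \<in> borel_measurable (mu_alpha \<alpha>)"
    and w_nonneg: "\<And>z. 0 \<le> w z"
    and w_nonzero: "\<not> (AE z in mu_alpha \<alpha>. w z = 0)"
begin

sublocale finite_measure "mu_alpha \<alpha> :: (complex^'n) measure"
  by (rule finite_measure_mu_alpha[OF \<alpha>])

abbreviation M :: "(complex^'n) measure" where "M \<equiv> mu_alpha \<alpha>"
abbreviation W where "W \<equiv> wmeas \<alpha> w"
abbreviation W' where "W' \<equiv> wdual_meas \<alpha> p w"

lemma AE_p: "AE z in M. 1 < p z \<and> p0 \<le> p z \<and> p z \<le> p1"
  using p_ge AE_mu_alpha_ball
  by eventually_elim (use p0 p_le in force)

lemma AE_p_gt_1: "AE z in M. 1 < p z"
  using AE_p by eventually_elim simp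

lemma unit_ball_sets [measurable]: "unit_ball \<in> sets M"
  by simp

lemma W_unit_ball_nonzero: "W unit_ball \<noteq> 0"
proof
  assume "W unit_ball = 0"
  then have "AE z in M. ennreal (w z) * indicator unit_ball z = 0"
    unfolding wmeas_def by (subst (asm) nn_integral_0_iff_AE) auto
  with AE_mu_alpha_ball have "AE z in M. w z = 0"
    by eventually_elim (use w_nonneg in \<open>auto simp: order_antisym\<close>)
  with w_nonzero show False by contradiction
qed

lemma measure_pball_ge:
  "\<exists>k>0. \<forall>z r. z \<in> unit_ball \<longrightarrow> r > 1 - norm z \<longrightarrow>
     k * min r 1 powr (\<alpha> + DIM(complex^'n)) \<le> measure M (pball z r)"
proof (intro exI conjI allI impI)
  let ?k = "(2/5) powr \<alpha> * (1/10)^DIM(complex^'n)"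
  show "?k > 0" by simp
  fix z :: "complex^'n" and r assume "z \<in> unit_ball" "r > 1 - norm z"
  from emeasure_pball_ge[OF \<alpha> this]
  show "?k * min r 1 powr (\<alpha> + DIM(complex^'n)) \<le> measure M (pball z r)"
    by (simp only: emeasure_eq_measure ennreal_le_iff[OF measure_nonneg])
qed

lemma measure_pball_pos:
  assumes "z \<in> unit_ball" "r > 1 - norm z"
  shows "measure M (pball z r) > 0"
proof -
  obtain k where k: "k > 0"
    and "k * min r 1 powr (\<alpha> + DIM(complex^'n)) \<le> measure M (pball z r)"
    using measure_pball_ge assms by blast
  moreover have "k * min r 1 powr (\<alpha> + DIM(complex^'n)) > 0"
    using k assms by auto
  ultimately show ?thesis by linarith
qed

lemma measure_unit_ball_pos: "measure M unit_ball > 0"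
proof -
  have "pball 0 2 = (unit_ball :: (complex^'n) set)"
    by (auto simp: pball_def pdist_def)
  then show ?thesis
    using measure_pball_pos[of 0 2] by simp
qed

text \<open>The exponent 1 - p' is negative, so the dual weight vanishes nowhere (it is infinite
  where w = 0), and the ball has positive measure.\<close>

lemma W'_unit_ball_nonzero: "W' unit_ball \<noteq> 0"
proof
  assume "W' unit_ball = 0"
  then have "AE z in M. wpow (w z) (1 - conj_exp p z) * indicator unit_ball z = 0"
    unfolding wdual_meas_def by (subst (asm) nn_integral_0_iff_AE) measurable
  with AE_mu_alpha_ball AE_p have "AE z in M. False"
  proof eventually_elim
    case (elim z)
    then have "wpow (w z) (1 - conj_exp p z) = 0" "1 - conj_exp p z < 0"
      by (auto simp: conj_exp_def field_simps)
    then show False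
      using w_nonneg[of z] by (auto simp: wpow_def split: if_splits)
  qed
  then have "emeasure M UNIV = 0"
    by (subst (asm) AE_iff_measurable[where N = UNIV]) auto
  then have "emeasure M unit_ball = 0"
    using emeasure_mono[of unit_ball UNIV M] by simp
  then show False
    using measure_unit_ball_pos by (simp add: measure_def)
qed

text \<open>Points of the pseudo-ball have pseudo-distance less than \<open>r\<close> from its
  centre, so log-Hoelder continuity confines p to an interval of half-length
  \<open>?\<delta>\<close> around p(z). The harmonic mean lies in the same interval; hence the
  factor 2.\<close>

lemma p_avg_pball:
  assumes z: "z \<in> unit_ball" and r: "r > 1 - norm z"
  shows "p0 \<le> p_avg \<alpha> p (pball z r)" "p_avg \<alpha> p (pball z r) \<le> p1"
    and "AE \<zeta> in M. \<zeta> \<in> pball z r \<longrightarrow>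
      \<bar>p \<zeta> - p_avg \<alpha> p (pball z r)\<bar> \<le> 2 * c / ln (exp 1 + 1 / r)"
proof -
  let ?B = "pball z r"
  let ?\<delta> = "c / ln (exp 1 + 1 / r)"
  have r0: "r > 0" using z r by auto
  have osc: "\<bar>p z - p \<zeta>\<bar> \<le> ?\<delta>" if "\<zeta> \<in> ?B" for \<zeta>
  proof (cases "z = \<zeta>")
    case True
    then show ?thesis
      using c ln_exp1_plus_ge_1[of "1 / r"] r0 by simp
  next
    case False
    have d: "pdist z \<zeta> > 0" "pdist z \<zeta> < r"
      using that pdist_pos[OF False] by (auto simp: pball_def)
    have "\<bar>p z - p \<zeta>\<bar> \<le> c / ln (exp 1 + 1 / pdist z \<zeta>)"
      using that z False by (intro log_Hoelder) (auto simp: pball_def)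
    also have "\<dots> \<le> ?\<delta>"
    proof (rule divide_left_mono[OF _ c])
      have "1 / r \<le> 1 / pdist z \<zeta>"
        using d by (intro divide_left_mono) auto
      moreover have "0 < exp 1 + 1 / r"
        using r0 by (auto intro: add_pos_pos)
      ultimately show "ln (exp 1 + 1 / r) \<le> ln (exp 1 + 1 / pdist z \<zeta>)"
        by (intro ln_mono) auto
      show "0 < ln (exp 1 + 1 / pdist z \<zeta>) * ln (exp 1 + 1 / r)"
        using ln_exp1_plus_ge_1[of "1 / r"] ln_exp1_plus_ge_1[of "1 / pdist z \<zeta>"] r0 d
        by (intro mult_pos_pos) auto
    qed
    finally show ?thesis .
  qed
  \<comment> \<open>The maximum with \<open>p0\<close> keeps the lower bound positive even if
    \<open>p z - ?\<delta>\<close> is not.\<close>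
  have "AE \<zeta> in M. \<zeta> \<in> ?B \<longrightarrow> max p0 (p z - ?\<delta>) \<le> p \<zeta> \<and> p \<zeta> \<le> min p1 (p z + ?\<delta>)"
    using AE_p by eventually_elim (use osc in \<open>fastforce simp: abs_le_iff\<close>)
  note avg = p_avg_bounds[OF finite_measure_mu_alpha[OF \<alpha>] p_measurable pball_in_sets
      measure_pball_pos[OF z r] _ this]
  have lo: "0 < max p0 (p z - ?\<delta>)"
    using p0 by simp
  have avg1: "max p0 (p z - ?\<delta>) \<le> p_avg \<alpha> p ?B" and avg2: "p_avg \<alpha> p ?B \<le> min p1 (p z + ?\<delta>)"
    using avg[OF lo] by blast+
  then show "p0 \<le> p_avg \<alpha> p ?B" "p_avg \<alpha> p ?B \<le> p1"
    by auto
  have "\<bar>p \<zeta> - p_avg \<alpha> p ?B\<bar> \<le> 2 * ?\<delta>" if "\<zeta> \<in> ?B" for \<zeta>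
    using osc[OF that] avg1 avg2 by (simp add: abs_le_iff)
  then show "AE \<zeta> in M. \<zeta> \<in> ?B \<longrightarrow> \<bar>p \<zeta> - p_avg \<alpha> p ?B\<bar> \<le> 2 * c / ln (exp 1 + 1 / r)"
    by simp
qed

text \<open>\<open>enn2real\<close> sends infinity to 0, so a bound on \<open>Q\<close> is
  meaningful only where both masses are finite; \<open>finite_total\<close> is therefore established
  before \<open>Q\<close> is compared with anything.\<close>

definition Q :: "(complex^'n) set \<Rightarrow> real" where
  "Q B = measure M B powr (- p_avg \<alpha> p B) * enn2real (W B) * enn2real (W' B) powr (p_avg \<alpha> p B - 1)"

abbreviation norm_p where
  "norm_p B \<equiv> vnorm \<alpha> p (\<lambda>z. indicator B z * wpow (w z) (1 / p z))"
abbreviation norm_conj where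
  "norm_conj B \<equiv> vnorm \<alpha> (conj_exp p) (\<lambda>z. indicator B z * wpow (w z) (- 1 / p z))"
abbreviation norm_quot where
  "norm_quot B \<equiv> vnorm \<alpha> (\<lambda>z. conj_exp p z / p z) (\<lambda>z. indicator B z * wpow (w z) (- 1))"

lemma pballs_cases:
  assumes "B \<in> pballs"
  obtains z r where "z \<in> unit_ball" "r > 1 - norm z" "B = pball z r"
  using assms by (auto simp: pballs_def)

lemma p0_le_p1: "p0 \<le> p1"
  using p_avg_pball(1,2)[of 0 2] by simp

text \<open>These facts exclude the product 0 * infinity = 0 of extended reals: with every norm
  nonzero, a finite product bounds each norm, and a finite norm excludes an infinite
  modular.\<close>

lemma unit_ball_norms:
  shows "norm_p unit_ball \<noteq> 0" "norm_conj unit_ball \<noteq> 0" "norm_quot unit_ball \<noteq> 0"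
    and "W unit_ball = \<infinity> \<Longrightarrow> norm_p unit_ball = \<infinity>"
    and "W' unit_ball = \<infinity> \<Longrightarrow> norm_conj unit_ball = \<infinity>"
    and "W' unit_ball = \<infinity> \<Longrightarrow> norm_quot unit_ball = \<infinity>"
proof -
  have b1: "AE z in M. 1 \<le> p z \<and> p z \<le> p1"
    using AE_p by eventually_elim simp
  have b2: "AE z in M. 1 \<le> conj_exp p z \<and> conj_exp p z \<le> p1 / (p0 - 1)"
    using AE_p by eventually_elim (use conj_exp_bounds p0 in auto)
  have b3: "AE z in M. 1 / p1 \<le> conj_exp p z / p z \<and> conj_exp p z / p z \<le> 1 / (p0 - 1)"
    using AE_p by eventually_elim (use conj_exp_bounds p0 in auto)
  have p1: "1 / p1 > 0"
    using p0 p0_le_p1 by simp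
  show "norm_p unit_ball \<noteq> 0"
    by (rule vnorm_pos[OF _ _ _ b1])
      (simp_all add: modular_wpow_p[OF AE_p_gt_1 w_nonneg] W_unit_ball_nonzero)
  show "norm_conj unit_ball \<noteq> 0"
    by (rule vnorm_pos[OF _ _ _ b2])
      (simp_all add: modular_wpow_conj[OF AE_p_gt_1 w_nonneg, simplified] W'_unit_ball_nonzero)
  show "norm_quot unit_ball \<noteq> 0"
    by (rule vnorm_pos[OF _ _ p1 b3])
      (simp_all add: modular_wpow_neg_one[OF AE_p_gt_1 w_nonneg] W'_unit_ball_nonzero)
  show "norm_p unit_ball = \<infinity>" if "W unit_ball = \<infinity>"
    by (rule vnorm_eq_top[where b = p1])
      (use b1 in \<open>auto simp: modular_wpow_p[OF AE_p_gt_1 w_nonneg] that elim!: eventually_mono\<close>)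
  show "norm_conj unit_ball = \<infinity>" if "W' unit_ball = \<infinity>"
    by (rule vnorm_eq_top[where b = "p1 / (p0 - 1)"])
      (use b2 in \<open>auto simp: modular_wpow_conj[OF AE_p_gt_1 w_nonneg, simplified] that elim!: eventually_mono\<close>)
  show "norm_quot unit_ball = \<infinity>" if "W' unit_ball = \<infinity>"
  proof (rule vnorm_eq_top[where b = "1 / (p0 - 1)"])
    show "AE z in M. 0 \<le> conj_exp p z / p z \<and> conj_exp p z / p z \<le> 1 / (p0 - 1)"
      using b3 by eventually_elim (use p1 in linarith)
  qed (auto simp: modular_wpow_neg_one[OF AE_p_gt_1 w_nonneg] that)
qed

definition finite_total :: bool where
  "finite_total \<longleftrightarrow> W unit_ball < \<infinity> \<and> W' unit_ball < \<infinity>"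

lemma class_B_imp_finite_total:
  assumes "class_B \<alpha> p w"
  shows "finite_total"
proof -
  obtain C where "inverse (emeasure M unit_ball) * norm_p unit_ball * norm_conj unit_ball \<le> ennreal C"
    using assms unit_ball_in_pballs unfolding class_B_def by blast
  then have "inverse (emeasure M unit_ball) * norm_p unit_ball * norm_conj unit_ball < \<infinity>"
    by (rule le_less_trans) simp
  moreover have "inverse (emeasure M unit_ball) \<noteq> 0"
    by (simp add: emeasure_eq_measure)
  ultimately have "norm_p unit_ball < \<infinity>" "norm_conj unit_ball < \<infinity>"
    using unit_ball_norms(1,2) by (auto simp: ennreal_mult_less_top less_top)
  then have "W unit_ball \<noteq> \<infinity>" "W' unit_ball \<noteq> \<infinity>"
    using unit_ball_norms(4,5) by (metis less_irrefl infinity_ennreal_def)+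
  then show ?thesis
    by (simp add: finite_total_def less_top)
qed

lemma class_B_plus_imp_finite_total:
  assumes "class_B_plus \<alpha> p w"
  shows "finite_total"
proof -
  obtain C where "ennreal (measure M unit_ball powr (- p_avg \<alpha> p unit_ball)) * W unit_ball * norm_quot unit_ball \<le> ennreal C"
    using assms unit_ball_in_pballs unfolding class_B_plus_def by blast
  then have "ennreal (measure M unit_ball powr (- p_avg \<alpha> p unit_ball)) * W unit_ball * norm_quot unit_ball < \<infinity>"
    by (rule le_less_trans) simp
  moreover have "ennreal (measure M unit_ball powr (- p_avg \<alpha> p unit_ball)) \<noteq> 0"
    using measure_unit_ball_pos by simp
  ultimately have "W unit_ball < \<infinity>" "norm_quot unit_ball < \<infinity>"
    using unit_ball_norms(3) W_unit_ball_nonzero by (auto simp: ennreal_mult_less_top less_top)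
  then have "W unit_ball \<noteq> \<infinity>" "W' unit_ball \<noteq> \<infinity>"
    using unit_ball_norms(6) by (metis less_irrefl infinity_ennreal_def)+
  then show ?thesis
    by (simp add: finite_total_def less_top)
qed

lemma class_B_plus_plus_imp_finite_total:
  assumes "class_B_plus_plus \<alpha> p w"
  shows "finite_total"
proof -
  have m: "emeasure M unit_ball = ennreal (measure M unit_ball)"
    by (simp add: emeasure_eq_measure)
  let ?E = "epow (W' unit_ball / emeasure M unit_ball) (p_avg \<alpha> p unit_ball - 1)"
  obtain C where "W unit_ball / emeasure M unit_ball * ?E \<le> ennreal C"
    using assms unit_ball_in_pballs unfolding class_B_plus_plus_def by blast
  then have less: "W unit_ball / emeasure M unit_ball * ?E < \<infinity>"
    by (rule le_less_trans) simp
  have 1: "W unit_ball / emeasure M unit_ball \<noteq> 0"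
    using W_unit_ball_nonzero by (simp add: m ennreal_divide_eq_0_iff)
  have 2: "?E \<noteq> 0"
  proof (cases "W' unit_ball / emeasure M unit_ball")
    case (real x)
    moreover have "W' unit_ball / emeasure M unit_ball \<noteq> 0"
      using W'_unit_ball_nonzero by (simp add: m ennreal_divide_eq_0_iff)
    ultimately show ?thesis
      by (auto simp: epow_def)
  qed (simp add: epow_def)
  from less 1 2 have fin: "W unit_ball / emeasure M unit_ball < \<infinity>" "?E < \<infinity>"
    by (auto simp: ennreal_mult_less_top less_top)
  have "W unit_ball \<noteq> \<infinity>"
    using fin(1) by (auto simp: m ennreal_top_divide)
  moreover have "W' unit_ball \<noteq> \<infinity>"
    using fin(2) by (auto simp: m ennreal_top_divide epow_def)
  ultimately show ?thesis
    by (simp add: finite_total_def less_top)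
qed

section \<open>Uniform estimates on pseudo-balls\<close>

text \<open>The logarithms of both masses are at most a constant times ln(e + 1/r), while p differs
  from its average by at most 2c / ln(e + 1/r). The logarithm cancels in the product, so
  \<open>A\<close> depends on neither the centre nor the radius.\<close>

lemma weights_on_pball:
  assumes fin: finite_total
  obtains A where "A \<ge> 0"
    and "\<And>B. B \<in> pballs \<Longrightarrow> \<exists>X>0. \<exists>Y>0. W B = ennreal X \<and> W' B = ennreal Y \<and>
      (AE \<zeta> in M. \<zeta> \<in> B \<longrightarrow> \<bar>ln X\<bar> * \<bar>p \<zeta> - p_avg \<alpha> p B\<bar> \<le> A \<and> \<bar>ln Y\<bar> * \<bar>p \<zeta> - p_avg \<alpha> p B\<bar> \<le> A)"
proof -
  define K where "K = max 1 (max (measure M unit_ball) (max (enn2real (W unit_ball)) (enn2real (W' unit_ball))))"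
  have K: "K > 0" "measure M unit_ball \<le> K" "W unit_ball \<le> ennreal K" "W' unit_ball \<le> ennreal K"
  proof -
    show "K > 0" "measure M unit_ball \<le> K"
      by (auto simp: K_def less_max_iff_disj le_max_iff_disj)
    have "ennreal (enn2real (W unit_ball)) \<le> ennreal K" "ennreal (enn2real (W' unit_ball)) \<le> ennreal K"
      by (auto simp: K_def le_max_iff_disj intro!: ennreal_leI)
    then show "W unit_ball \<le> ennreal K" "W' unit_ball \<le> ennreal K"
      using fin by (auto simp: finite_total_def)
  qed
  let ?N = "\<alpha> + DIM(complex^'n)"
  obtain k where k: "k > 0" "\<And>z r. z \<in> unit_ball \<Longrightarrow> r > 1 - norm z \<Longrightarrow> k * min r 1 powr ?N \<le> measure M (pball z r)"
    using measure_pball_ge by blast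
  define D where "D m = (1 + m) * (\<bar>ln k\<bar> + ?N) + ln 2 + m * \<bar>ln (2 * K)\<bar> + \<bar>ln K\<bar>" for m :: real
  have D: "0 \<le> D m" if "m \<ge> 0" for m
    using that \<alpha> unfolding D_def by (intro add_nonneg_nonneg mult_nonneg_nonneg) auto
  define q where "q = 1 / (p0 - 1)"
  have q: "q \<ge> 0" "p1 \<ge> 0"
    using p0 p0_le_p1 by (auto simp: q_def)
  define A where "A = max (D p1) (D q) * (2 * c)"
  have A0: "A \<ge> 0"
    unfolding A_def using D q c by (intro mult_nonneg_nonneg) (auto simp: le_max_iff_disj)
  show thesis
  proof (rule that[OF A0])
    fix B :: "(complex^'n) set" assume "B \<in> pballs"
    then obtain z r where z: "z \<in> unit_ball" and r: "r > 1 - norm z" and B: "B = pball z r"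
      by (rule pballs_cases)
    have r0: "r > 0" using z r by auto
    have sub: "B \<subseteq> unit_ball" and B_sets [measurable]: "B \<in> sets M"
      unfolding B by (auto simp: pball_def)
    have mB: "measure M B > 0" "k * min r 1 powr ?N \<le> measure M B"
      unfolding B using measure_pball_pos k z r by auto
    have mBK: "measure M B \<le> K"
      using finite_measure_mono[OF sub] K(2) by simp
    have WB: "W B \<le> ennreal K" "W' B \<le> ennreal K"
    proof -
      have "W B \<le> W unit_ball" "W' B \<le> W' unit_ball"
        unfolding wmeas_def wdual_meas_def using sub
        by (auto intro!: nn_integral_mono mult_left_mono simp: indicator_def)
      then show "W B \<le> ennreal K" "W' B \<le> ennreal K"
        using K by auto
    qed
    \<comment> \<open>The two masses bound each other: the upper bound on w'(B) yields the lower
      bound on w(B), and the upper bound on w(B) yields the one on w'(B).\<close>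
    have lowW: "ennreal (measure M B / 2 * (measure M B / (2 * K)) powr p1) \<le> W B"
      unfolding wmeas_def
    proof (rule set_nn_integral_poly_lower[where g = "\<lambda>z. wpow (w z) (1 - conj_exp p z)"])
      show "AE z in M. 1 \<le> ennreal s * wpow (w z) (1 - conj_exp p z) + ennreal (s powr - p1) * ennreal (w z)"
        if "0 < s" "s \<le> 1" for s
        using AE_p by eventually_elim (use that w_nonneg in \<open>auto intro!: weight_sum_ge_1\<close>)
    qed (use B_sets WB mB mBK finite_measure_axioms in \<open>auto simp: wdual_meas_def\<close>)
    have lowW': "ennreal (measure M B / 2 * (measure M B / (2 * K)) powr q) \<le> W' B"
      unfolding wdual_meas_def
    proof (rule set_nn_integral_poly_lower[where g = "\<lambda>z. ennreal (w z)"])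
      show "AE z in M. 1 \<le> ennreal s * ennreal (w z) + ennreal (s powr - q) * wpow (w z) (1 - conj_exp p z)"
        if "0 < s" "s \<le> 1" for s
        using AE_p unfolding q_def
        by eventually_elim (use that w_nonneg p0 in \<open>auto intro!: dual_weight_sum_ge_1\<close>)
    qed (use B_sets WB mB mBK finite_measure_axioms in \<open>auto simp: wmeas_def\<close>)
    obtain X where X: "W B = ennreal X" "0 \<le> X" "X \<le> K"
      using WB(1) K(1) by (cases "W B") (auto simp: top_unique)
    obtain Y where Y: "W' B = ennreal Y" "0 \<le> Y" "Y \<le> K"
      using WB(2) K(1) by (cases "W' B") (auto simp: top_unique)
    have X': "measure M B / 2 * (measure M B / (2 * K)) powr p1 \<le> X"
      using lowW X by (simp add: ennreal_le_iff)
    have Y': "measure M B / 2 * (measure M B / (2 * K)) powr q \<le> Y"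
      using lowW' Y by (simp add: ennreal_le_iff)
    have "measure M B / 2 * (measure M B / (2 * K)) powr e > 0" for e
      using mB K by simp
    then have pos: "X > 0" "Y > 0"
      using X' Y' by (meson less_le_trans)+
    have N0: "?N \<ge> 0" using \<alpha> by simp
    let ?L = "ln (exp 1 + 1 / r)"
    have L: "?L \<ge> 1"
      using r0 by (intro ln_exp1_plus_ge_1) auto
    have "\<bar>ln X\<bar> \<le> D p1 * ?L" "\<bar>ln Y\<bar> \<le> D q * ?L"
      unfolding D_def
      using abs_ln_le_of_poly_bounds[OF mB(2) k(1) K(1) r0 N0 X' X(3)]
        abs_ln_le_of_poly_bounds[OF mB(2) k(1) K(1) r0 N0 Y' Y(3)] q by auto
    moreover have "D p1 * ?L \<le> max (D p1) (D q) * ?L" "D q * ?L \<le> max (D p1) (D q) * ?L"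
      using L by (auto intro!: mult_right_mono)
    ultimately have ln: "\<bar>ln X\<bar> \<le> max (D p1) (D q) * ?L" "\<bar>ln Y\<bar> \<le> max (D p1) (D q) * ?L"
      by linarith+
    have prod: "v * d \<le> A" if "v \<le> max (D p1) (D q) * ?L" "d \<le> 2 * c / ?L" "0 \<le> v" "0 \<le> d" for v d
    proof -
      have "v * d \<le> (max (D p1) (D q) * ?L) * (2 * c / ?L)"
        using that by (intro mult_mono) auto
      also have "\<dots> = A"
        using L by (simp add: A_def)
      finally show ?thesis .
    qed
    have "AE \<zeta> in M. \<zeta> \<in> B \<longrightarrow> \<bar>ln X\<bar> * \<bar>p \<zeta> - p_avg \<alpha> p B\<bar> \<le> A \<and> \<bar>ln Y\<bar> * \<bar>p \<zeta> - p_avg \<alpha> p B\<bar> \<le> A"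
      using p_avg_pball(3)[OF z r] unfolding B[symmetric]
      by eventually_elim (use ln prod in auto)
    with pos X Y show "\<exists>X>0. \<exists>Y>0. W B = ennreal X \<and> W' B = ennreal Y \<and>
      (AE \<zeta> in M. \<zeta> \<in> B \<longrightarrow> \<bar>ln X\<bar> * \<bar>p \<zeta> - p_avg \<alpha> p B\<bar> \<le> A \<and> \<bar>ln Y\<bar> * \<bar>p \<zeta> - p_avg \<alpha> p B\<bar> \<le> A)"
      by blast
  qed
qed

text \<open>The comparison of norm and modular is applied to the pairs (exponent, averaged exponent)
  = (p, 1/b), (p', 1 - 1/b) and (p'/p, b - 1) with b = p_B. In each case the product of the pair
  minus 1 is p - b up to sign times a bounded factor, which is what the oscillation estimate
  controls.\<close>

lemma norms_on_pball:
  assumes fin: finite_total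
  obtains C where "C \<ge> 0"
    and "\<And>B. B \<in> pballs \<Longrightarrow> \<exists>X>0. \<exists>Y>0. W B = ennreal X \<and> W' B = ennreal Y \<and>
      (\<exists>N1 N2 N3. norm_p B = ennreal N1 \<and> norm_conj B = ennreal N2 \<and> norm_quot B = ennreal N3 \<and>
        exp (- C) * X powr (1 / p_avg \<alpha> p B) \<le> N1 \<and> N1 \<le> exp C * X powr (1 / p_avg \<alpha> p B) \<and>
        exp (- C) * Y powr (1 - 1 / p_avg \<alpha> p B) \<le> N2 \<and> N2 \<le> exp C * Y powr (1 - 1 / p_avg \<alpha> p B) \<and>
        exp (- C) * Y powr (p_avg \<alpha> p B - 1) \<le> N3 \<and> N3 \<le> exp C * Y powr (p_avg \<alpha> p B - 1))"
proof -
  obtain A where A: "A \<ge> 0"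
    and est: "\<And>B. B \<in> pballs \<Longrightarrow> \<exists>X>0. \<exists>Y>0. W B = ennreal X \<and> W' B = ennreal Y \<and>
      (AE \<zeta> in M. \<zeta> \<in> B \<longrightarrow> \<bar>ln X\<bar> * \<bar>p \<zeta> - p_avg \<alpha> p B\<bar> \<le> A \<and> \<bar>ln Y\<bar> * \<bar>p \<zeta> - p_avg \<alpha> p B\<bar> \<le> A)"
    using weights_on_pball[OF fin] by blast
  define E where "E = A / (p0 - 1)"
  have E: "E \<ge> 0"
    using A p0 by (simp add: E_def)
  have p1: "p1 > 0" using p0 p0_le_p1 by simp
  \<comment> \<open>\<open>C\<close> dominates the three quotients C/a of the norm comparison: lower
    bounds of the exponents p, p' and p'/p are 1, 1 and 1/p1.\<close>
  define C where "C = A + E + E * p1"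
  have C: "A / 1 \<le> C" "E / 1 \<le> C" "E / (1 / p1) \<le> C" "C \<ge> 0"
    using A E p1 by (auto simp: C_def)
  have sandwich: "\<exists>N. v = ennreal N \<and> exp (- C) * P \<le> N \<and> N \<le> exp C * P"
    if "v \<le> ennreal (exp D * P)" "ennreal (exp (- D) * P) \<le> v" "D \<le> C" "P \<ge> 0" for v D P
  proof -
    have "v < top"
      using that(1) by (rule le_less_trans) (rule ennreal_less_top)
    then obtain N where N: "v = ennreal N" "0 \<le> N"
      by (cases v) auto
    then have "N \<le> exp D * P" "exp (- D) * P \<le> N"
      using that by (simp_all add: ennreal_le_iff)
    moreover have "exp D * P \<le> exp C * P" "exp (- C) * P \<le> exp (- D) * P"
      using that by (auto intro!: mult_right_mono)
    ultimately show ?thesis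
      using N by (intro exI[of _ N]) auto
  qed
  show thesis
  proof (rule that[OF C(4)])
    fix B :: "(complex^'n) set" assume Bp: "B \<in> pballs"
    then obtain z r where z: "z \<in> unit_ball" and r: "r > 1 - norm z" and B: "B = pball z r"
      by (rule pballs_cases)
    have [measurable]: "B \<in> sets M"
      unfolding B by (rule pball_in_sets)
    obtain X Y where X: "X > 0" "W B = ennreal X" and Y: "Y > 0" "W' B = ennreal Y"
      and osc: "AE \<zeta> in M. \<zeta> \<in> B \<longrightarrow> \<bar>ln X\<bar> * \<bar>p \<zeta> - p_avg \<alpha> p B\<bar> \<le> A \<and> \<bar>ln Y\<bar> * \<bar>p \<zeta> - p_avg \<alpha> p B\<bar> \<le> A"
      using est[OF Bp] by blast
    define b where "b = p_avg \<alpha> p B"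
    have b: "p0 \<le> b" "b > 1"
      using p_avg_pball(1)[OF z r] p0 by (auto simp: b_def B)
    have scale: "v * \<bar>q\<bar> \<le> A / d" if "v * \<bar>s\<bar> \<le> A" "0 \<le> v" "\<bar>q\<bar> \<le> \<bar>s\<bar> / d" "d > 0" for v q s d :: real
    proof -
      have "v * \<bar>q\<bar> \<le> v * (\<bar>s\<bar> / d)"
        using that by (intro mult_left_mono) auto
      also have "\<dots> \<le> A / d"
        using that divide_right_mono[OF that(1), of d] by simp
      finally show ?thesis .
    qed
    have 1: "AE z in M. indicator B z * wpow (w z) (1 / p z) \<noteq> 0 \<longrightarrow>
        1 \<le> p z \<and> \<bar>ln X\<bar> * \<bar>1 / b * p z - 1\<bar> \<le> A"
      using AE_p osc
    proof eventually_elim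
      case (elim z)
      have "\<bar>1 / b * p z - 1\<bar> = \<bar>p z - b\<bar> / b"
        using b by (simp add: abs_if field_simps)
      also have "\<dots> \<le> \<bar>p z - b\<bar> / 1"
        using b by (intro divide_left_mono) auto
      finally have "\<bar>1 / b * p z - 1\<bar> \<le> \<bar>p z - b\<bar> / 1" .
      then show ?case
        using elim scale[of "\<bar>ln X\<bar>" "p z - b" "1 / b * p z - 1" 1]
        by (auto simp: b_def indicator_def split: if_splits)
    qed
    have q_dev: "\<bar>(b - 1) / (p z - 1) - 1\<bar> \<le> \<bar>p z - b\<bar> / (p0 - 1)"
      if "p0 \<le> p z" for z
    proof -
      have "(b - 1) / (p z - 1) - 1 = (b - p z) / (p z - 1)"
        using that p0 by (simp add: field_simps)
      then have "\<bar>(b - 1) / (p z - 1) - 1\<bar> = \<bar>p z - b\<bar> / (p z - 1)"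
        using that p0 by (simp add: abs_minus_commute)
      also have "\<dots> \<le> \<bar>p z - b\<bar> / (p0 - 1)"
        using that p0 by (intro divide_left_mono) auto
      finally show ?thesis .
    qed
    have 2: "AE z in M. indicator B z * wpow (w z) (- 1 / p z) \<noteq> 0 \<longrightarrow>
        1 \<le> conj_exp p z \<and> \<bar>ln Y\<bar> * \<bar>(1 - 1 / b) * conj_exp p z - 1\<bar> \<le> E"
      using AE_p osc
    proof eventually_elim
      case (elim z)
      \<comment> \<open>Both sides equal (b - p)/(b(p - 1)); the conjugate deviation is thus the
        quotient deviation divided by b > 1.\<close>
      have "(1 - 1 / b) * conj_exp p z - 1 = ((b - 1) / (p z - 1) - 1) / b"
        using b elim by (simp add: conj_exp_def field_simps)
      then have "\<bar>(1 - 1 / b) * conj_exp p z - 1\<bar> = \<bar>(b - 1) / (p z - 1) - 1\<bar> / b"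
        using b by simp
      also have "\<dots> \<le> \<bar>(b - 1) / (p z - 1) - 1\<bar> / 1"
        using b by (intro divide_left_mono) auto
      also have "\<dots> \<le> \<bar>p z - b\<bar> / (p0 - 1)"
        using q_dev elim by simp
      finally show ?case
        using elim scale[of "\<bar>ln Y\<bar>" "p z - b" "(1 - 1 / b) * conj_exp p z - 1" "p0 - 1"] p0
          conj_exp_bounds(1)[of p0 p z p1]
        by (auto simp: b_def E_def indicator_def split: if_splits)
    qed
    have 3: "AE z in M. indicator B z * wpow (w z) (- 1) \<noteq> 0 \<longrightarrow>
        1 / p1 \<le> conj_exp p z / p z \<and> \<bar>ln Y\<bar> * \<bar>(b - 1) * (conj_exp p z / p z) - 1\<bar> \<le> E"
      using AE_p osc
    proof eventually_elim
      case (elim z)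
      have "(b - 1) * (conj_exp p z / p z) - 1 = (b - 1) / (p z - 1) - 1"
        using elim by (simp add: conj_exp_def)
      then show ?case
        using elim scale[of "\<bar>ln Y\<bar>" "p z - b" "(b - 1) / (p z - 1) - 1" "p0 - 1"] p0 q_dev[of z]
          conj_exp_bounds(3)[of p0 p z p1]
        by (auto simp: b_def E_def indicator_def split: if_splits)
    qed
    have p1': "1 / p1 > 0" using p1 by simp
    have "\<exists>N1. norm_p B = ennreal N1 \<and> exp (- C) * X powr (1 / b) \<le> N1 \<and> N1 \<le> exp C * X powr (1 / b)"
      by (rule sandwich[OF vnorm_bounds(1,2)[OF _ _ _ A X(1) 1] C(1)])
        (simp_all add: modular_wpow_p[OF AE_p_gt_1 w_nonneg] X)
    moreover have "\<exists>N2. norm_conj B = ennreal N2 \<and> exp (- C) * Y powr (1 - 1 / b) \<le> N2 \<and> N2 \<le> exp C * Y powr (1 - 1 / b)"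
      by (rule sandwich[OF vnorm_bounds(1,2)[OF _ _ _ E Y(1) 2] C(2)])
        (simp_all add: modular_wpow_conj[OF AE_p_gt_1 w_nonneg, simplified] Y)
    moreover have "\<exists>N3. norm_quot B = ennreal N3 \<and> exp (- C) * Y powr (b - 1) \<le> N3 \<and> N3 \<le> exp C * Y powr (b - 1)"
      by (rule sandwich[OF vnorm_bounds(1,2)[OF _ _ p1' E Y(1) 3] C(3)])
        (simp_all add: modular_wpow_neg_one[OF AE_p_gt_1 w_nonneg] Y)
    ultimately show "\<exists>X>0. \<exists>Y>0. W B = ennreal X \<and> W' B = ennreal Y \<and>
      (\<exists>N1 N2 N3. norm_p B = ennreal N1 \<and> norm_conj B = ennreal N2 \<and> norm_quot B = ennreal N3 \<and>
        exp (- C) * X powr (1 / p_avg \<alpha> p B) \<le> N1 \<and> N1 \<le> exp C * X powr (1 / p_avg \<alpha> p B) \<and>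
        exp (- C) * Y powr (1 - 1 / p_avg \<alpha> p B) \<le> N2 \<and> N2 \<le> exp C * Y powr (1 - 1 / p_avg \<alpha> p B) \<and>
        exp (- C) * Y powr (p_avg \<alpha> p B - 1) \<le> N3 \<and> N3 \<le> exp C * Y powr (p_avg \<alpha> p B - 1))"
      unfolding b_def[symmetric] using X Y by blast
  qed
qed

section \<open>The three conditions as boundedness of \<open>Q\<close>\<close>

lemma Q_bounded_iff:
  assumes fin: finite_total
  shows "class_B \<alpha> p w \<longleftrightarrow> (\<exists>K. \<forall>B\<in>pballs. Q B \<le> K)"
    and "class_B_plus \<alpha> p w \<longleftrightarrow> (\<exists>K. \<forall>B\<in>pballs. Q B \<le> K)"
    and "class_B_plus_plus \<alpha> p w \<longleftrightarrow> (\<exists>K. \<forall>B\<in>pballs. Q B \<le> K)"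
proof -
  obtain C where C: "C \<ge> 0"
    and est: "\<And>B. B \<in> pballs \<Longrightarrow> \<exists>X>0. \<exists>Y>0. W B = ennreal X \<and> W' B = ennreal Y \<and>
      (\<exists>N1 N2 N3. norm_p B = ennreal N1 \<and> norm_conj B = ennreal N2 \<and> norm_quot B = ennreal N3 \<and>
        exp (- C) * X powr (1 / p_avg \<alpha> p B) \<le> N1 \<and> N1 \<le> exp C * X powr (1 / p_avg \<alpha> p B) \<and>
        exp (- C) * Y powr (1 - 1 / p_avg \<alpha> p B) \<le> N2 \<and> N2 \<le> exp C * Y powr (1 - 1 / p_avg \<alpha> p B) \<and>
        exp (- C) * Y powr (p_avg \<alpha> p B - 1) \<le> N3 \<and> N3 \<le> exp C * Y powr (p_avg \<alpha> p B - 1))"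
    using norms_on_pball[OF fin] by blast
  have B_facts: "measure M B > 0" "1 < p_avg \<alpha> p B" "p_avg \<alpha> p B \<le> p1" if "B \<in> pballs" for B
    using pballs_cases[OF that] measure_pball_pos p_avg_pball(1,2) p0 by (metis less_le_trans)+
  have Q_nonneg: "Q B \<ge> 0" for B
    by (simp add: Q_def)

  have base: "\<exists>v. inverse (emeasure M B) * norm_p B * norm_conj B = ennreal v \<and>
      exp (- (2 * C)) * Q B powr (1 / p_avg \<alpha> p B) \<le> v \<and> v \<le> exp (2 * C) * Q B powr (1 / p_avg \<alpha> p B)"
    if Bp: "B \<in> pballs" for B
  proof -
    define b \<mu> where "b = p_avg \<alpha> p B" and "\<mu> = measure M B"
    have b: "b > 1" and \<mu>: "\<mu> > 0"
      using B_facts[OF Bp] by (auto simp: b_def \<mu>_def)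
    obtain X Y N1 N2 where X: "X > 0" "W B = ennreal X" and Y: "Y > 0" "W' B = ennreal Y"
      and N: "norm_p B = ennreal N1" "norm_conj B = ennreal N2"
      and N1: "exp (- C) * X powr (1 / b) \<le> N1" "N1 \<le> exp C * X powr (1 / b)"
      and N2: "exp (- C) * Y powr (1 - 1 / b) \<le> N2" "N2 \<le> exp C * Y powr (1 - 1 / b)"
      using est[OF Bp] unfolding b_def[symmetric] by blast
    have N0: "0 \<le> N1" "0 \<le> N2"
      using N1(1) N2(1) by (meson order_trans mult_nonneg_nonneg exp_ge_zero powr_ge_zero)+
    \<comment> \<open>\<open>R\<close> is the product in \<open>class_B\<close> with each norm
      replaced by its power of the modular. The root of order p_B turns m^(-p_B) into 1/m, hence R =
      Q^(1/p_B).\<close>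
    define R where "R = X powr (1 / b) * Y powr (1 - 1 / b) / \<mu>"
    have R: "Q B powr (1 / b) = R"
    proof -
      have "Q B = \<mu> powr (- b) * X * Y powr (b - 1)"
        using X Y by (simp add: Q_def b_def \<mu>_def)
      then have "Q B powr (1 / b) = \<mu> powr (- b * (1 / b)) * X powr (1 / b) * Y powr ((b - 1) * (1 / b))"
        using X by (simp only: powr_mult powr_powr)
      also have "- b * (1 / b) = - 1" using b by simp
      also have "(b - 1) * (1 / b) = 1 - 1 / b" using b by (simp add: field_simps)
      finally show ?thesis
        using \<mu> by (simp add: R_def powr_minus_divide)
    qed
    have "exp (- C) * X powr (1 / b) * (exp (- C) * Y powr (1 - 1 / b)) \<le> N1 * N2"
      using N0 N1 N2 by (intro mult_mono) auto
    moreover have "exp (- C) * X powr (1 / b) * (exp (- C) * Y powr (1 - 1 / b)) / \<mu> = exp (- (2 * C)) * R"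
      by (simp add: R_def mult_ac flip: exp_add)
    ultimately have 1: "exp (- (2 * C)) * R \<le> N1 * N2 / \<mu>"
      using \<mu> by (metis divide_right_mono less_imp_le)
    have "N1 * N2 \<le> exp C * X powr (1 / b) * (exp C * Y powr (1 - 1 / b))"
      using N0 N1 N2 by (intro mult_mono) auto
    moreover have "exp C * X powr (1 / b) * (exp C * Y powr (1 - 1 / b)) / \<mu> = exp (2 * C) * R"
      by (simp add: R_def mult_ac flip: exp_add)
    ultimately have 2: "N1 * N2 / \<mu> \<le> exp (2 * C) * R"
      using \<mu> by (metis divide_right_mono less_imp_le)
    have "inverse (emeasure M B) * norm_p B * norm_conj B = ennreal (inverse \<mu> * N1 * N2)"
      using \<mu> N0 unfolding N
      by (simp add: emeasure_eq_measure inverse_ennreal ennreal_mult flip: \<mu>_def)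
    also have "inverse \<mu> * N1 * N2 = N1 * N2 / \<mu>"
      by (simp add: field_simps)
    finally show ?thesis
      using 1 2 unfolding b_def[symmetric] R by blast
  qed
  have plus: "\<exists>v. ennreal (measure M B powr (- p_avg \<alpha> p B)) * W B * norm_quot B = ennreal v \<and>
      exp (- C) * Q B \<le> v \<and> v \<le> exp C * Q B"
    if Bp: "B \<in> pballs" for B
  proof -
    define b \<mu> where "b = p_avg \<alpha> p B" and "\<mu> = measure M B"
    obtain X Y N3 where X: "X > 0" "W B = ennreal X" and Y: "Y > 0" "W' B = ennreal Y"
      and N: "norm_quot B = ennreal N3"
      and N3: "exp (- C) * Y powr (b - 1) \<le> N3" "N3 \<le> exp C * Y powr (b - 1)"
      using est[OF Bp] unfolding b_def[symmetric] by blast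
    have N0: "0 \<le> N3"
      using N3(1) by (meson order_trans mult_nonneg_nonneg exp_ge_zero powr_ge_zero)
    have Q: "Q B = \<mu> powr (- b) * X * Y powr (b - 1)"
      using X Y by (simp add: Q_def b_def \<mu>_def)
    have "(\<mu> powr (- b) * X) * (exp (- C) * Y powr (b - 1)) \<le> (\<mu> powr (- b) * X) * N3"
      "(\<mu> powr (- b) * X) * N3 \<le> (\<mu> powr (- b) * X) * (exp C * Y powr (b - 1))"
      using N3 X by (auto intro!: mult_left_mono)
    moreover have "ennreal (\<mu> powr (- b)) * W B * norm_quot B = ennreal (\<mu> powr (- b) * X * N3)"
      using X N0 unfolding N by (simp add: ennreal_mult)
    ultimately show ?thesis
      unfolding b_def[symmetric] \<mu>_def[symmetric] Q by (intro exI[of _ "\<mu> powr (- b) * X * N3"]) (simp add: mult_ac)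
  qed
  have plus_plus: "W B / emeasure M B * epow (W' B / emeasure M B) (p_avg \<alpha> p B - 1) = ennreal (Q B)"
    if Bp: "B \<in> pballs" for B
  proof -
    define b \<mu> where "b = p_avg \<alpha> p B" and "\<mu> = measure M B"
    have b: "b > 1" and \<mu>: "\<mu> > 0"
      using B_facts[OF Bp] by (auto simp: b_def \<mu>_def)
    obtain X Y where X: "X > 0" "W B = ennreal X" and Y: "Y > 0" "W' B = ennreal Y"
      using est[OF Bp] by blast
    have "W B / emeasure M B * epow (W' B / emeasure M B) (b - 1) = ennreal (X / \<mu>) * ennreal ((Y / \<mu>) powr (b - 1))"
      using X Y \<mu> by (simp add: emeasure_eq_measure divide_ennreal epow_def flip: \<mu>_def)
    also have "\<dots> = ennreal (X / \<mu> * (Y / \<mu>) powr (b - 1))"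
      using X \<mu> by (intro ennreal_mult[symmetric]) auto
    also have "X / \<mu> * (Y / \<mu>) powr (b - 1) = \<mu> powr (- b) * X * Y powr (b - 1)"
    proof -
      have "\<mu> powr (- b) = 1 / (\<mu> * \<mu> powr (b - 1))"
        using \<mu> by (simp add: powr_minus_divide powr_diff)
      then show ?thesis
        using \<mu> Y by (simp add: powr_divide)
    qed
    also have "\<dots> = Q B"
      using X Y by (simp add: Q_def b_def \<mu>_def)
    finally show ?thesis
      by (simp add: b_def)
  qed

  show "class_B \<alpha> p w \<longleftrightarrow> (\<exists>K. \<forall>B\<in>pballs. Q B \<le> K)"
  proof
    assume "class_B \<alpha> p w"
    then obtain K where K: "\<And>B. B \<in> pballs \<Longrightarrow> inverse (emeasure M B) * norm_p B * norm_conj B \<le> ennreal K"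
      unfolding class_B_def by blast
    \<comment> \<open>T \<ge> 1 makes T^b \<le> T^p1, so undoing the root costs a power that does
      not depend on \<open>B\<close>. The maximum with 0 covers a negative \<open>K\<close>, for
      which \<open>ennreal K\<close> is 0.\<close>
    define T where "T = max 1 (exp (2 * C) * max 0 K)"
    have "Q B \<le> T powr p1" if Bp: "B \<in> pballs" for B
    proof -
      define b where "b = p_avg \<alpha> p B"
      have b: "b > 1" "b \<le> p1"
        using B_facts[OF Bp] by (auto simp: b_def)
      obtain v where "inverse (emeasure M B) * norm_p B * norm_conj B = ennreal v"
        "exp (- (2 * C)) * Q B powr (1 / b) \<le> v"
        using base[OF Bp] unfolding b_def[symmetric] by blast
      with K[OF Bp] have "ennreal v \<le> ennreal K" and v: "exp (- (2 * C)) * Q B powr (1 / b) \<le> v"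
        by auto
      then have "v \<le> max 0 K"
        by (cases "v \<le> 0") (auto simp: ennreal_le_iff2)
      with v have "exp (- (2 * C)) * Q B powr (1 / b) \<le> max 0 K"
        by linarith
      then have "exp (2 * C) * (exp (- (2 * C)) * Q B powr (1 / b)) \<le> exp (2 * C) * max 0 K"
        by (intro mult_left_mono) auto
      moreover have "exp (2 * C) * (exp (- (2 * C)) * Q B powr (1 / b)) = Q B powr (1 / b)"
        by (simp flip: mult.assoc exp_add)
      ultimately have "Q B powr (1 / b) \<le> T"
        unfolding T_def by linarith
      then have "(Q B powr (1 / b)) powr b \<le> T powr b"
        using b by (intro powr_mono2) auto
      also have "(Q B powr (1 / b)) powr b = Q B"
        using b Q_nonneg[of B] by (simp add: powr_powr)
      also have "T powr b \<le> T powr p1"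
        using b by (intro powr_mono) (auto simp: T_def)
      finally show ?thesis .
    qed
    then show "\<exists>K. \<forall>B\<in>pballs. Q B \<le> K" by blast
  next
    assume "\<exists>K. \<forall>B\<in>pballs. Q B \<le> K"
    then obtain K where K: "\<And>B. B \<in> pballs \<Longrightarrow> Q B \<le> K" by blast
    have "inverse (emeasure M B) * norm_p B * norm_conj B \<le> ennreal (exp (2 * C) * max 1 K)"
      if Bp: "B \<in> pballs" for B
    proof -
      define b where "b = p_avg \<alpha> p B"
      have b: "b > 1" "b \<le> p1"
        using B_facts[OF Bp] by (auto simp: b_def)
      obtain v where v: "inverse (emeasure M B) * norm_p B * norm_conj B = ennreal v"
        "v \<le> exp (2 * C) * Q B powr (1 / b)"
        using base[OF Bp] unfolding b_def[symmetric] by blast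
      \<comment> \<open>Replacing \<open>K\<close> by \<open>max 1 K\<close> makes the base at least
        1, so that the exponent 1/b may be raised to 1.\<close>
      have "Q B powr (1 / b) \<le> max 1 K powr (1 / b)"
        using b K[OF Bp] Q_nonneg[of B] by (intro powr_mono2) auto
      also have "\<dots> \<le> max 1 K powr 1"
        using b by (intro powr_mono) auto
      finally have "exp (2 * C) * Q B powr (1 / b) \<le> exp (2 * C) * max 1 K"
        by simp
      with v(2) have "v \<le> exp (2 * C) * max 1 K"
        by (rule order_trans)
      then show ?thesis
        unfolding v(1) by (rule ennreal_leI)
    qed
    then show "class_B \<alpha> p w"
      unfolding class_B_def by blast
  qed

  show "class_B_plus \<alpha> p w \<longleftrightarrow> (\<exists>K. \<forall>B\<in>pballs. Q B \<le> K)"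
  proof
    assume "class_B_plus \<alpha> p w"
    then obtain K where K: "\<And>B. B \<in> pballs \<Longrightarrow>
        ennreal (measure M B powr (- p_avg \<alpha> p B)) * W B * norm_quot B \<le> ennreal K"
      unfolding class_B_plus_def by blast
    have "Q B \<le> exp C * max 0 K" if Bp: "B \<in> pballs" for B
    proof -
      obtain v where "ennreal (measure M B powr (- p_avg \<alpha> p B)) * W B * norm_quot B = ennreal v"
        and v: "exp (- C) * Q B \<le> v"
        using plus[OF Bp] by blast
      with K[OF Bp] have "ennreal v \<le> ennreal K" by auto
      then have "v \<le> max 0 K"
        by (cases "v \<le> 0") (auto simp: ennreal_le_iff2)
      with v have "exp (- C) * Q B \<le> max 0 K"
        by linarith
      then have "exp C * (exp (- C) * Q B) \<le> exp C * max 0 K"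
        by (intro mult_left_mono) auto
      then show ?thesis
        by (simp flip: mult.assoc exp_add)
    qed
    then show "\<exists>K. \<forall>B\<in>pballs. Q B \<le> K" by blast
  next
    assume "\<exists>K. \<forall>B\<in>pballs. Q B \<le> K"
    then obtain K where K: "\<And>B. B \<in> pballs \<Longrightarrow> Q B \<le> K" by blast
    have "ennreal (measure M B powr (- p_avg \<alpha> p B)) * W B * norm_quot B \<le> ennreal (exp C * K)"
      if Bp: "B \<in> pballs" for B
    proof -
      obtain v where v: "ennreal (measure M B powr (- p_avg \<alpha> p B)) * W B * norm_quot B = ennreal v"
        "v \<le> exp C * Q B"
        using plus[OF Bp] by blast
      have "exp C * Q B \<le> exp C * K"
        using K[OF Bp] by simp
      with v(2) have "v \<le> exp C * K"
        by (rule order_trans)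
      then show ?thesis
        unfolding v(1) by (rule ennreal_leI)
    qed
    then show "class_B_plus \<alpha> p w"
      unfolding class_B_plus_def by blast
  qed

  show "class_B_plus_plus \<alpha> p w \<longleftrightarrow> (\<exists>K. \<forall>B\<in>pballs. Q B \<le> K)"
  proof
    assume "class_B_plus_plus \<alpha> p w"
    then obtain K where K: "\<And>B. B \<in> pballs \<Longrightarrow> ennreal (Q B) \<le> ennreal K"
      unfolding class_B_plus_plus_def using plus_plus by metis
    have "Q B \<le> max 0 K" if "B \<in> pballs" for B
      using K[OF that] by (cases "Q B \<le> 0") (auto simp: ennreal_le_iff2)
    then show "\<exists>K. \<forall>B\<in>pballs. Q B \<le> K" by blast
  next
    assume "\<exists>K. \<forall>B\<in>pballs. Q B \<le> K"
    then obtain K where "\<And>B. B \<in> pballs \<Longrightarrow> Q B \<le> K" by blast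
    then show "class_B_plus_plus \<alpha> p w"
      unfolding class_B_plus_plus_def by (intro exI[of _ K] ballI) (simp add: plus_plus ennreal_leI)
  qed
qed

text \<open>If \<open>finite_total\<close> fails, none of the three conditions holds and the
  equivalences are vacuous; otherwise all three say that \<open>Q\<close> is bounded.\<close>

lemma classes_coincide:
  "(class_B \<alpha> p w \<longleftrightarrow> class_B_plus \<alpha> p w) \<and> (class_B_plus \<alpha> p w \<longleftrightarrow> class_B_plus_plus \<alpha> p w)"
  using Q_bounded_iff class_B_imp_finite_total class_B_plus_imp_finite_total
    class_B_plus_plus_imp_finite_total by blast

end

section \<open>Passing from \<open>P_log\<close> to explicit bounds\<close>

lemma P_log_upper_bound:
  assumes "z \<in> unit_ball" "\<zeta> \<in> unit_ball" "c \<ge> 0"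
    and "z \<noteq> \<zeta> \<Longrightarrow> \<bar>p z - p \<zeta>\<bar> \<le> c / ln (exp 1 + 1 / pdist z \<zeta>)"
  shows "p z \<le> p \<zeta> + c"
proof (cases "z = \<zeta>")
  case False
  then have "\<bar>p z - p \<zeta>\<bar> \<le> c / ln (exp 1 + 1 / pdist z \<zeta>)"
    using assms by blast
  also have "\<dots> \<le> c / 1"
    using ln_exp1_plus_ge_1[of "1 / pdist z \<zeta>"] pdist_pos[OF False] assms
    by (intro divide_left_mono) auto
  finally show ?thesis by simp
qed (use assms in simp)

theorem mainTheorem10:
  fixes \<alpha> :: real and p w :: "complex^'n \<Rightarrow> real"
  assumes "\<alpha> > 0"
    and "P_log \<alpha> p"
    and "is_weight \<alpha> w"
    and "\<not> (AE z in mu_alpha \<alpha>. w z = 0)"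
  shows "(class_B \<alpha> p w \<longleftrightarrow> class_B_plus \<alpha> p w)
       \<and> (class_B_plus \<alpha> p w \<longleftrightarrow> class_B_plus_plus \<alpha> p w)"
proof -
  from \<open>P_log \<alpha> p\<close> obtain p0 c where p: "p \<in> borel_measurable (mu_alpha \<alpha>)"
    and p0: "p0 > 1" "AE z in mu_alpha \<alpha>. p0 \<le> p z"
    and c: "\<And>z \<zeta>. z \<in> unit_ball \<Longrightarrow> \<zeta> \<in> unit_ball \<Longrightarrow> z \<noteq> \<zeta> \<Longrightarrow>
      \<bar>p z - p \<zeta>\<bar> \<le> c / ln (exp 1 + 1 / pdist z \<zeta>)"
    unfolding P_log_def by blast
  \<comment> \<open>The constant of the log-Hoelder condition carries no sign, so its absolute value
    is used from here on.\<close>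
  have c': "\<bar>p z - p \<zeta>\<bar> \<le> \<bar>c\<bar> / ln (exp 1 + 1 / pdist z \<zeta>)"
    if "z \<in> unit_ball" "\<zeta> \<in> unit_ball" "z \<noteq> \<zeta>" for z \<zeta>
  proof -
    have "c / ln (exp 1 + 1 / pdist z \<zeta>) \<le> \<bar>c\<bar> / ln (exp 1 + 1 / pdist z \<zeta>)"
      using ln_exp1_plus_ge_1[of "1 / pdist z \<zeta>"] pdist_pos[OF that(3)]
      by (intro divide_right_mono) auto
    with c[OF that] show ?thesis by linarith
  qed
  \<comment> \<open>The upper bound on p is the comparison with the origin, where the logarithm in
    the denominator is at least 1.\<close>
  interpret weighted_log_exponent \<alpha> p0 "p 0 + \<bar>c\<bar>" "\<bar>c\<bar>" p w
  proof
    show "p z \<le> p 0 + \<bar>c\<bar>" if "z \<in> unit_ball" for z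
      using that by (intro P_log_upper_bound c') auto
  qed (use assms p p0 c' in \<open>auto simp: is_weight_def\<close>)
  show ?thesis
    by (rule classes_coincide)
qed

end
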